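(* Let $0\le k\le N-1$ and let $G_N$ be a simple graph on $N$ vertices with minimum degree at least $N-k-1$. Consider the affinity-scheduling graph model on $G_N$ with arrival rate $\lambda>0$ per vertex and service rates $\mu_1>\mu_2>0$, and a reference system with $N$ servers, total arrival rate $\lambda N$, service rate $\mu_1$ at each server, operating under the MJSQ($k$) policy. If the initial configurations satisfy $\overline{Q}^{\mathrm{aff}}_{m+}(0)\le \overline{Q}^{\mathrm{MJSQ}(k)}_{m+}(0)$ for all $m\ge 1$, then $$\{(\overline{Q}_{m+}^{\mathrm{aff}}(t))_{m \geq 1}\}_{t \geq 0} \ \leq_{\mathrm{st}}\ \{(\overline{Q}_{m+}^{\mathrm{MJSQ}(k)}(t))_{m \geq 1}\}_{t \geq 0}.$$
   Context: **Affinity-scheduling graph model.** There are $N$ servers, identified with the vertices of $G_N$. At each vertex $v$ jobs arrive according to an independent Poisson process of rate $\lambda$; the selection of primary servers for such a job is the closed neighborhood $S=\{v\}\cup\{\text{neighbors of }v\}$, and the servers in $S^c$ are its secondary servers. A job allocated to a primary server becomes a type I job there (exponential service requirement with rate $\mu_1$); a job allocated to a secondary server becomes a type II job there (exponential service requirement with rate $\mu_2<\mu_1$); all service times are independent. Allocation of a job arriving with selection $S$: 1. If some server in $S$ is completely idle (no jobs), allocate the job as type I to one of these idle servers. 2. Otherwise, if some server in $S^c$ is completely idle, allocate the job as type II to one of these idle servers. 3. Otherwise, allocate the job as type I to the server in $S$ with the smallest number of type I jobs, ties being broken in favor of fewer type II jobs. Any remaining ties are broken by an arbitrary (possibly randomized)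 rule depending only on the current state and $S$. Each server uses preemptive priority in favor of type I jobs, type I jobs being served in order of arrival: a server with at least one type I job completes type I jobs at rate $\mu_1$; a server with no type I jobs but at least one type II job completes type II jobs at rate $\mu_2$. Initially there are finitely many jobs; initial configurations are deterministic. **MJSQ($k$) reference system.** There are $N$ servers with a single type of job; jobs arrive as a Poisson process of rate $\lambda N$; each arriving job is assigned to the server with the $(k+1)$-th smallest queue length (servers ordered by nondecreasing number of jobs, ties ordered arbitrarily); each server serves first-come first-served with independent exponential service times of rate $\mu_1$. **Notation.** $\overline{Q}^{\mathrm{aff}}_i(t)$ is the number of servers with at least $i$ type I jobs at time $t$ in the graph model, and $\overline{Q}^{\mathrm{MJSQ}(k)}_i(t)$ is the number of servers with at least $i$ jobs (including any in service) at time $t$ in the MJSQ($k$) system. Put $\overline{Q}_{m+}(t)=\sum_{i\ge m}\overline{Q}_i(t)$ with the corresponding superscript. **Stochastic order.** $\{(X_m(t))_{m\ge1}\}_{t\ge0}\le_{\mathrm{st}}\{(Y_m(t))_{m\ge1}\}_{t\ge0}$ means that the two processes can be constructed on a common probability space (with their respective laws) such that almost surely $X_m(t)\le Y_m(t)$ for all $m\ge1$ and $t\ge0$. *)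

theory Defs
  imports "HOL-Probability.Probability"
begin

section \<open>Continuous-time Markov chains with prescribed transition rates\<close>

definition exit_rate :: "('a \<Rightarrow> 'a \<Rightarrow> real) \<Rightarrow> 'a \<Rightarrow> real" where
  "exit_rate q x = (\<Sum>\<^sub>\<infinity>y\<in>-{x}. q x y)"

definition jump_prob :: "('a \<Rightarrow> 'a \<Rightarrow> real) \<Rightarrow> 'a \<Rightarrow> 'a \<Rightarrow> real" where
  "jump_prob q x y = (if y = x then 0 else q x y / exit_rate q x)"

text \<open>
  \<open>X\<close> is a jump process started in \<open>x0\<close> with jump chain \<open>Y\<close> and holding times \<open>S\<close>: in state \<open>x\<close> the
  process stays for an exponential time with rate \<open>exit_rate q x\<close> and then, independently, jumps to
  \<open>y\<close> with probability \<open>q x y / exit_rate q x\<close>. The product formula below determines the joint law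
  of \<open>Y\<close> and \<open>S\<close>, hence the law of \<open>X\<close> if there is no explosion. Holding times are real numbers,
  so the definition is meant for rates without absorbing states and with bounded \<open>exit_rate q\<close>; this
  is the case for both queueing systems below, where the arrival rate is positive and there are
  finitely many servers.
\<close>
definition ctmc ::
  "('a::countable \<Rightarrow> 'a \<Rightarrow> real) \<Rightarrow> 'a \<Rightarrow> 'w measure \<Rightarrow> (real \<Rightarrow> 'w \<Rightarrow> 'a) \<Rightarrow> bool" where
  "ctmc q x0 M X \<longleftrightarrow>
     prob_space M \<and>
     (\<forall>t\<ge>0. X t \<in> measurable M (count_space UNIV)) \<and>
     (\<exists>(Y :: nat \<Rightarrow> 'w \<Rightarrow> 'a) (S :: nat \<Rightarrow> 'w \<Rightarrow> real).
        (\<forall>n. Y n \<in> measurable M (count_space UNIV)) \<and>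
        (\<forall>n. S n \<in> borel_measurable M) \<and>
        (\<forall>n y s. y 0 = x0 \<longrightarrow> (\<forall>i<n. 0 \<le> s i) \<longrightarrow>
           \<P>(\<omega> in M. Y 0 \<omega> = x0 \<and> (\<forall>i<n. Y (Suc i) \<omega> = y (Suc i) \<and> s i < S i \<omega>)) =
           (\<Prod>i<n. jump_prob q (y i) (y (Suc i)) * exp (- exit_rate q (y i) * s i))) \<and>
        (AE \<omega> in M. \<forall>n t. (\<Sum>i<n. S i \<omega>) \<le> t \<and> t < (\<Sum>i<Suc n. S i \<omega>) \<longrightarrow> X t \<omega> = Y n \<omega>))"


section \<open>The affinity-scheduling graph model\<close>

text \<open>
  A state records, for each server, the number of type I jobs and the number of type II jobs. The
  order in which jobs of one type are served is irrelevant for these counts, since service times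
  are independent and exponential.
\<close>
type_synonym 'v aff_state = "'v \<Rightarrow> nat \<times> nat"

definition closed_nbhd :: "('v \<Rightarrow> 'v \<Rightarrow> bool) \<Rightarrow> 'v \<Rightarrow> 'v set" where
  "closed_nbhd E v = insert v {w. E v w}"

definition idle :: "'v aff_state \<Rightarrow> 'v \<Rightarrow> bool" where
  "idle x s \<longleftrightarrow> x s = (0, 0)"

text \<open>The servers to which a job with selection \<open>S\<close> may be allocated in state \<open>x\<close>.\<close>
definition aff_candidates :: "'v aff_state \<Rightarrow> 'v set \<Rightarrow> 'v set" where
  "aff_candidates x S =
     (if \<exists>s\<in>S. idle x s then {s\<in>S. idle x s}
      else if \<exists>s\<in>-S. idle x s then {s\<in>-S. idle x s}
      else {s\<in>S. \<forall>r\<in>S. fst (x s) < fst (x r) \<or> fst (x s) = fst (x r) \<and> snd (x s) \<le> snd (x r)})"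

text \<open>
  \<open>R x S\<close> is the (possibly randomized) choice of the server for a job with selection \<open>S\<close> that finds
  the system in state \<open>x\<close>.
\<close>
definition aff_tie_rule ::
  "('v \<Rightarrow> 'v \<Rightarrow> bool) \<Rightarrow> ('v aff_state \<Rightarrow> 'v set \<Rightarrow> 'v pmf) \<Rightarrow> bool" where
  "aff_tie_rule E R \<longleftrightarrow>
     (\<forall>x v. set_pmf (R x (closed_nbhd E v)) \<subseteq> aff_candidates x (closed_nbhd E v))"

definition aff_arrival :: "'v set \<Rightarrow> 'v \<Rightarrow> 'v aff_state \<Rightarrow> 'v aff_state" where
  "aff_arrival S s x =
     (if s \<in> S then x(s := (Suc (fst (x s)), snd (x s))) else x(s := (fst (x s), Suc (snd (x s)))))"

definition aff_rate ::
  "('v::finite \<Rightarrow> 'v \<Rightarrow> bool) \<Rightarrow> ('v aff_state \<Rightarrow> 'v set \<Rightarrow> 'v pmf) \<Rightarrow> real \<Rightarrow> real \<Rightarrow> real \<Rightarrow>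
   'v aff_state \<Rightarrow> 'v aff_state \<Rightarrow> real" where
  "aff_rate E R lam \<mu>\<^sub>1 \<mu>\<^sub>2 x y =
     (\<Sum>v\<in>UNIV. lam * measure_pmf.prob (R x (closed_nbhd E v))
        {s. y = aff_arrival (closed_nbhd E v) s x}) +
     (\<Sum>s\<in>UNIV. if fst (x s) > 0 \<and> y = x(s := (fst (x s) - 1, snd (x s))) then \<mu>\<^sub>1 else 0) +
     (\<Sum>s\<in>UNIV. if fst (x s) = 0 \<and> snd (x s) > 0 \<and> y = x(s := (0, snd (x s) - 1)) then \<mu>\<^sub>2 else 0)"


section \<open>The MJSQ(k) reference system\<close>

text \<open>
  Every admissible choice is the server at position \<open>k\<close> (counting from 0) in some enumeration of
  the servers by nondecreasing queue length; \<open>T x\<close> may randomize over these servers.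
\<close>
definition mjsq_tie_rule :: "nat \<Rightarrow> (('s \<Rightarrow> nat) \<Rightarrow> 's pmf) \<Rightarrow> bool" where
  "mjsq_tie_rule k T \<longleftrightarrow>
     (\<forall>x. set_pmf (T x) \<subseteq>
       {xs ! k |xs. distinct xs \<and> set xs = UNIV \<and> sorted (map x xs)})"

definition mjsq_rate ::
  "(('s::finite \<Rightarrow> nat) \<Rightarrow> 's pmf) \<Rightarrow> real \<Rightarrow> real \<Rightarrow> ('s \<Rightarrow> nat) \<Rightarrow> ('s \<Rightarrow> nat) \<Rightarrow> real" where
  "mjsq_rate T lam \<mu>\<^sub>1 x y =
     lam * real CARD('s) * measure_pmf.prob (T x) {s. y = x(s := Suc (x s))} +
     (\<Sum>s\<in>UNIV. if x s > 0 \<and> y = x(s := x s - 1) then \<mu>\<^sub>1 else 0)"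


section \<open>Occupancy processes and stochastic order\<close>

text \<open>Here \<open>l s\<close> is the number of (type I) jobs at server \<open>s\<close>.\<close>
definition Qbar :: "('s::finite \<Rightarrow> nat) \<Rightarrow> nat \<Rightarrow> nat" where
  "Qbar l i = card {s. i \<le> l s}"

definition Qbar_plus :: "('s::finite \<Rightarrow> nat) \<Rightarrow> nat \<Rightarrow> nat" where
  "Qbar_plus l m = (\<Sum>\<^sub>\<infinity>i\<in>{m..}. Qbar l i)"

text \<open>Only finitely many terms of this sum are nonzero.\<close>
lemma Qbar_plus_eq_sum: "Qbar_plus l m = (\<Sum>i=m..Max (range l). Qbar l i)"
proof -
  have "Qbar l i = 0" if "i > Max (range l)" for i
  proof -
    have "l s < i" for s
      using that Max_ge[of "range l" "l s"] by simp
    then have "{s. i \<le> l s} = {}"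
      by (auto simp: not_le)
    then show ?thesis
      by (simp add: Qbar_def)
  qed
  then have "Qbar_plus l m = infsum (Qbar l) {m..Max (range l)}"
    unfolding Qbar_plus_def by (intro infsum_cong_neutral) (auto simp del: Max_less_iff)
  then show ?thesis
    by simp
qed

definition aff_process ::
  "('v::finite \<Rightarrow> 'v \<Rightarrow> bool) \<Rightarrow> ('v aff_state \<Rightarrow> 'v set \<Rightarrow> 'v pmf) \<Rightarrow> real \<Rightarrow> real \<Rightarrow> real \<Rightarrow>
   'v aff_state \<Rightarrow> 'w measure \<Rightarrow> (real \<Rightarrow> 'w \<Rightarrow> nat \<Rightarrow> nat) \<Rightarrow> bool" where
  "aff_process E R lam \<mu>\<^sub>1 \<mu>\<^sub>2 x0 M Z \<longleftrightarrow>
     (\<exists>X. ctmc (aff_rate E R lam \<mu>\<^sub>1 \<mu>\<^sub>2) x0 M X \<and>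
          Z = (\<lambda>t \<omega> m. Qbar_plus (fst \<circ> X t \<omega>) m))"

definition mjsq_process ::
  "(('s::finite \<Rightarrow> nat) \<Rightarrow> 's pmf) \<Rightarrow> real \<Rightarrow> real \<Rightarrow>
   ('s \<Rightarrow> nat) \<Rightarrow> 'w measure \<Rightarrow> (real \<Rightarrow> 'w \<Rightarrow> nat \<Rightarrow> nat) \<Rightarrow> bool" where
  "mjsq_process T lam \<mu>\<^sub>1 y0 M Z \<longleftrightarrow>
     (\<exists>X. ctmc (mjsq_rate T lam \<mu>\<^sub>1) y0 M X \<and> Z = (\<lambda>t \<omega> m. Qbar_plus (X t \<omega>) m))"

text \<open>
  \<open>\<A>\<close> and \<open>\<B>\<close> are models such as \<open>aff_process E R lam \<mu>\<^sub>1 \<mu>\<^sub>2 x0\<close>: \<open>\<A> M X\<close> says that \<open>X\<close> is a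
  realization on \<open>M\<close> of the first process. The sample space has carrier type
  \<open>nat \<Rightarrow> real\<close> (with an arbitrary \<open>\<sigma>\<close>-algebra), since one cannot quantify over types; any process
  with values in a standard Borel space and regular paths can be realized there.
\<close>
definition st_le ::
  "((nat \<Rightarrow> real) measure \<Rightarrow> (real \<Rightarrow> (nat \<Rightarrow> real) \<Rightarrow> nat \<Rightarrow> nat) \<Rightarrow> bool) \<Rightarrow>
   ((nat \<Rightarrow> real) measure \<Rightarrow> (real \<Rightarrow> (nat \<Rightarrow> real) \<Rightarrow> nat \<Rightarrow> nat) \<Rightarrow> bool) \<Rightarrow> bool"
  (infix \<open>\<le>\<^sub>s\<^sub>t\<close> 50) where
  "\<A> \<le>\<^sub>s\<^sub>t \<B> \<longleftrightarrow>
     (\<exists>M X Y. prob_space M \<and> \<A> M X \<and> \<B> M Y \<and>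
        (AE \<omega> in M. \<forall>m\<ge>1. \<forall>t\<ge>0. X t \<omega> m \<le> Y t \<omega> m))"

end

theory Submission
  imports Defs
begin

text \<open>
  Both systems are run on one Poisson clock of rate \<open>N * (lam + \<mu>\<^sub>1)\<close> (uniformization). At a tick, either
  a job arrives in both systems simultaneously, or a pair of servers of equal rank in the two orderings by
  queue length attempts a departure (a server without type I jobs completes a type II job with probability
  \<open>\<mu>\<^sub>2 / \<mu>\<^sub>1\<close>). Domination can only fail at a level \<open>m\<close> where \<open>Qbar_plus\<close> agrees in both systems. There
  domination at \<open>m + 1\<close> makes \<open>Qbar\<close> at \<open>m\<close> at least as large in the affinity system, so by equality of
  ranks a departure that lowers level \<open>m\<close> of the reference system also lowers that of the affinity
  system. An arrival that raises only the affinity system at \<open>m\<close> means that at least \<open>N - k\<close> servers there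
  have \<open>m - 1\<close> type I jobs, whereas fewer than \<open>N - k\<close> reference servers do, contradicting domination at
  \<open>m - 1\<close>. Each marginal of the uniformized chain is a jump process with the prescribed rates, because
  the law of the first jump satisfies a renewal equation whose bounded solution is unique.
\<close>

section \<open>Uniformized chains\<close>

type_synonym 'z sample = "(real \<times> ('z \<Rightarrow> 'z)) stream"

text \<open>
  A mark is a waiting time together with a random map of the state space, drawn independently at every
  state; evaluating the maps along the path turns i.i.d. marks into a chain with kernel \<open>K\<close>.
\<close>
definition mark_space :: "('z \<Rightarrow> 'z pmf) \<Rightarrow> real \<Rightarrow> (real \<times> ('z \<Rightarrow> 'z)) measure" where
  "mark_space K Lam =
     density lborel (exponential_density Lam) \<Otimes>\<^sub>M (\<Pi>\<^sub>M z\<in>UNIV. measure_pmf (K z))"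

primrec chain :: "'z \<Rightarrow> 'z sample \<Rightarrow> nat \<Rightarrow> 'z" where
  "chain z \<omega> 0 = z"
| "chain z \<omega> (Suc n) = chain (snd (shd \<omega>) z) (stl \<omega>) n"

definition event_time :: "'z sample \<Rightarrow> nat \<Rightarrow> real" where
  "event_time \<omega> n = (\<Sum>i<n. fst (\<omega> !! i))"

text \<open>For nonnegative waiting times and \<open>t \<ge> 0\<close> the index is the number of
  ticks up to time \<open>t\<close>. If the tick times never pass \<open>t\<close>, the index is
  unspecified, but the value is still a state of the chain; so invariants of the chain hold at all
  times without an argument about explosion.\<close>

definition jump_path :: "'z \<Rightarrow> real \<Rightarrow> 'z sample \<Rightarrow> 'z" where
  "jump_path z t \<omega> = chain z \<omega> (LEAST n. t < event_time \<omega> (Suc n))"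

section \<open>Paths of the chain, and coding of samples as real sequences\<close>

lemma chain_add: "chain z \<omega> (m + n) = chain (chain z \<omega> m) (sdrop m \<omega>) n"
  by (induction m arbitrary: z \<omega>) auto

lemma chain_Suc_right: "chain z \<omega> (Suc n) = snd (\<omega> !! n) (chain z \<omega> n)"
  by (induction n arbitrary: z \<omega>) auto

lemma event_time_0 [simp]: "event_time \<omega> 0 = 0"
  by (simp add: event_time_def)

lemma event_time_Stream: "event_time (a ## \<omega>) (Suc n) = fst a + event_time \<omega> n"
  by (simp add: event_time_def sum.lessThan_Suc_shift del: sum.lessThan_Suc)

lemma event_time_add: "event_time \<omega> (m + n) = event_time \<omega> m + event_time (sdrop m \<omega>) n"
  by (induction n) (auto simp: event_time_def sdrop_snth)

lemma event_time_mono: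
  assumes "\<And>i. 0 \<le> fst (\<omega> !! i)" "m \<le> n"
  shows "event_time \<omega> m \<le> event_time \<omega> n"
  unfolding event_time_def by (rule sum_mono2) (use assms in auto)

text \<open>\<open>st_le\<close> asks for sample points of type
  \<open>nat \<Rightarrow> real\<close>. The code of a sample stores under \<open>(i, 0)\<close> the
  waiting time of mark \<open>i\<close>, and under \<open>(i, Suc j)\<close> the number of the state
  to which the map of mark \<open>i\<close> sends the \<open>j\<close>-th state.\<close>

lemma inj_sample_embedding:
  "inj (\<lambda>(\<omega> :: 'z::countable sample) n. case prod_decode n of
     (i, j) \<Rightarrow> case j of 0 \<Rightarrow> fst (\<omega> !! i) | Suc j \<Rightarrow> real (to_nat (snd (\<omega> !! i) (from_nat j))))"
  (is "inj ?g")
proof (rule injI)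
  fix \<omega> \<omega>' :: "'z sample" assume eq: "?g \<omega> = ?g \<omega>'"
  have "\<omega> !! i = \<omega>' !! i" for i
  proof (rule prod_eqI)
    show "fst (\<omega> !! i) = fst (\<omega>' !! i)"
      using fun_cong[OF eq, of "prod_encode (i, 0)"] by simp
    show "snd (\<omega> !! i) = snd (\<omega>' !! i)"
    proof
      fix z :: 'z
      show "snd (\<omega> !! i) z = snd (\<omega>' !! i) z"
        using fun_cong[OF eq, of "prod_encode (i, Suc (to_nat z))"] by simp
    qed
  qed
  then have "snth \<omega> = snth \<omega>'" by (rule ext)
  then show "\<omega> = \<omega>'"
    using stream_smap_nats[of \<omega>] stream_smap_nats[of \<omega>'] by simp
qed

lemma measurable_inv_embed_measure:
  assumes "inj g" "f \<in> measurable M N"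
  shows "(\<lambda>\<omega>. f (inv g \<omega>)) \<in> measurable (embed_measure M g) N"
  by (rule measurable_embed_measure1) (use assms in simp)

text \<open>An injection carries the space over together with its \<sigma>-algebra, and
  \<open>inv g\<close> recovers the original sample; hence all events keep their
  probabilities.\<close>

lemma ctmc_embed_measure:
  fixes q :: "'a::countable \<Rightarrow> 'a \<Rightarrow> real"
  assumes "ctmc q x0 M X" and inj: "inj g"
  shows "ctmc q x0 (embed_measure M g) (\<lambda>t \<omega>. X t (inv g \<omega>))"
proof -
  interpret prob_space M using assms by (simp add: ctmc_def)
  let ?M = "embed_measure M g"
  have M_eq: "?M = distr M ?M g" by (rule embed_measure_eq_distr[OF inj])
  have g[measurable]: "g \<in> measurable M ?M" by (rule measurable_embed_measure2[OF inj])
  note inv = measurable_inv_embed_measure[OF inj]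
  have P: "\<P>(\<omega> in ?M. Q (inv g \<omega>)) = \<P>(\<omega> in M. Q \<omega>)" if "Measurable.pred M Q" for Q
  proof -
    have [measurable]: "Measurable.pred ?M (\<lambda>\<omega>. Q (inv g \<omega>))" by (rule inv[OF that])
    have "\<P>(\<omega> in ?M. Q (inv g \<omega>)) = measure (distr M ?M g) {\<omega>\<in>space ?M. Q (inv g \<omega>)}"
      by (rule arg_cong[where f="\<lambda>N. measure N _", OF M_eq])
    also have "\<dots> = measure M (g -` {\<omega>\<in>space ?M. Q (inv g \<omega>)} \<inter> space M)"
      by (rule measure_distr) measurable
    also have "g -` {\<omega>\<in>space ?M. Q (inv g \<omega>)} \<inter> space M = {\<omega>\<in>space M. Q \<omega>}"
      using inj by (auto simp: space_embed_measure)
    finally show ?thesis .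
  qed
  from assms obtain Y S where Y[measurable]: "\<And>n. Y n \<in> measurable M (count_space UNIV)"
    and S[measurable]: "\<And>n. S n \<in> borel_measurable M"
    and X: "\<And>t. t \<ge> 0 \<Longrightarrow> X t \<in> measurable M (count_space UNIV)"
    and prob: "\<And>n y s. y 0 = x0 \<Longrightarrow> (\<forall>i<n. 0 \<le> s i) \<Longrightarrow>
           \<P>(\<omega> in M. Y 0 \<omega> = x0 \<and> (\<forall>i<n. Y (Suc i) \<omega> = y (Suc i) \<and> s i < S i \<omega>)) =
           (\<Prod>i<n. jump_prob q (y i) (y (Suc i)) * exp (- exit_rate q (y i) * s i))"
    and AE: "AE \<omega> in M. \<forall>n t. (\<Sum>i<n. S i \<omega>) \<le> t \<and> t < (\<Sum>i<Suc n. S i \<omega>) \<longrightarrow> X t \<omega> = Y n \<omega>"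
    unfolding ctmc_def by blast
  show ?thesis
    unfolding ctmc_def
  proof (intro conjI exI[of _ "\<lambda>n \<omega>. Y n (inv g \<omega>)"] exI[of _ "\<lambda>n \<omega>. S n (inv g \<omega>)"] allI impI)
    show "prob_space ?M" by (subst M_eq) (rule prob_space_distr[OF g])
    show "(\<lambda>\<omega>. X t (inv g \<omega>)) \<in> ?M \<rightarrow>\<^sub>M count_space UNIV" if "0 \<le> t" for t
      by (rule inv[OF X[OF that]])
    show "(\<lambda>\<omega>. Y n (inv g \<omega>)) \<in> ?M \<rightarrow>\<^sub>M count_space UNIV" for n by (rule inv[OF Y])
    show "(\<lambda>\<omega>. S n (inv g \<omega>)) \<in> borel_measurable ?M" for n by (rule inv[OF S])
    show "AE \<omega> in ?M. \<forall>n t. (\<Sum>i<n. S i (inv g \<omega>)) \<le> t \<and> t < (\<Sum>i<Suc n. S i (inv g \<omega>)) \<longrightarrow>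
        X t (inv g \<omega>) = Y n (inv g \<omega>)"
      using AE inj by (simp add: AE_embed_measure)
    fix n and y :: "nat \<Rightarrow> 'a" and s :: "nat \<Rightarrow> real" assume "y 0 = x0" "\<forall>i<n. 0 \<le> s i"
    then show "\<P>(\<omega> in ?M. Y 0 (inv g \<omega>) = x0 \<and> (\<forall>i<n. Y (Suc i) (inv g \<omega>) = y (Suc i) \<and> s i < S i (inv g \<omega>))) =
           (\<Prod>i<n. jump_prob q (y i) (y (Suc i)) * exp (- exit_rate q (y i) * s i))"
      using P[of "\<lambda>\<omega>. Y 0 \<omega> = x0 \<and> (\<forall>i<n. Y (Suc i) \<omega> = y (Suc i) \<and> s i < S i \<omega>)"] prob by simp
  qed
qed

section \<open>I.i.d. marks: laws, integrals and almost sure properties\<close>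

locale poisson_clock =
  fixes K :: "'z::countable \<Rightarrow> 'z pmf" and Lam :: real
  assumes Lam_pos: "0 < Lam"
begin

abbreviation "E \<equiv> density lborel (exponential_density Lam)"
abbreviation "B \<equiv> mark_space K Lam"
abbreviation "SS \<equiv> stream_space B"

sublocale E: prob_space E
  using Lam_pos by (rule prob_space_exponential_density)

sublocale Mk: prob_space "\<Pi>\<^sub>M z\<in>UNIV. measure_pmf (K z)"
  by (rule prob_space_PiM) (simp add: measure_pmf.prob_space_axioms)

sublocale B: prob_space B
  unfolding mark_space_def by (rule prob_space_pair) unfold_locales

sublocale SS: prob_space SS
  by (rule B.prob_space_stream_space)

lemma space_B [simp]: "space B = UNIV"
  by (simp add: mark_space_def space_pair_measure space_PiM)

lemma space_SS [simp]: "space SS = UNIV"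
  by (simp add: space_stream_space)

lemma measurable_fst_B [measurable]: "fst \<in> borel_measurable B"
proof -
  have "(\<lambda>w. w) \<in> borel_measurable E"
    by simp
  then show ?thesis
    unfolding mark_space_def by (rule measurable_compose[OF measurable_fst])
qed

lemma measurable_apply_mark [measurable]: "(\<lambda>a. snd a z) \<in> measurable B (count_space UNIV)"
proof -
  have "(\<lambda>m. m z) \<in> measurable (\<Pi>\<^sub>M z\<in>UNIV. measure_pmf (K z)) (count_space UNIV)"
    using measurable_component_singleton[of z UNIV "\<lambda>z. measure_pmf (K z)"]
    by (simp cong: measurable_cong_sets)
  then show ?thesis
    unfolding mark_space_def by measurable
qed

lemma measurable_chain [measurable]: "(\<lambda>\<omega>. chain z \<omega> n) \<in> measurable SS (count_space UNIV)"
proof (induction n arbitrary: z)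
  case (Suc n)
  have [measurable]: "(\<lambda>\<omega>. snd (shd \<omega>) z) \<in> measurable SS (count_space UNIV)"
    by (rule measurable_compose[OF measurable_shd measurable_apply_mark])
  have [measurable]: "(\<lambda>\<omega>. chain z' (stl \<omega>) n) \<in> measurable SS (count_space UNIV)" for z'
    by (rule measurable_compose[OF measurable_stl Suc])
  show ?case
    unfolding chain.simps by (rule measurable_compose_countable[where g="\<lambda>\<omega>. snd (shd \<omega>) z"]) measurable
qed simp

lemma measurable_event_time [measurable]: "(\<lambda>\<omega>. event_time \<omega> n) \<in> borel_measurable SS"
  unfolding event_time_def
  by (intro borel_measurable_sum measurable_compose[OF measurable_snth measurable_fst_B])

lemma measurable_jump_path [measurable]: "jump_path z t \<in> measurable SS (count_space UNIV)"
  unfolding jump_path_def[abs_def]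
  by (rule measurable_compose_countable[where g="\<lambda>\<omega>. LEAST n. t < event_time \<omega> (Suc n)"]) measurable

text \<open>The waiting time is independent of the map, and the value of the map at \<open>z\<close>
  has law \<open>K z\<close>, so the expectation factors. The bounds serve integrability.\<close>

lemma integral_mark:
  fixes f :: "real \<Rightarrow> real" and g :: "'z \<Rightarrow> real"
  assumes [measurable]: "f \<in> borel_measurable borel" and f: "\<And>w. \<bar>f w\<bar> \<le> c" and g: "\<And>z'. \<bar>g z'\<bar> \<le> d"
  shows "(\<integral>a. f (fst a) * g (snd a z) \<partial>B) = (\<integral>w. f w \<partial>E) * (\<integral>z'. g z' \<partial>K z)"
proof -
  let ?P = "\<Pi>\<^sub>M z\<in>UNIV. measure_pmf (K z)"
  interpret pair_prob_space E ?P ..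
  have "\<bar>f w * g z'\<bar> \<le> c * d" for w z'
    using mult_mono[OF f[of w] g[of z']] f[of w] by (simp add: abs_mult)
  then have int: "integrable B (\<lambda>a. f (fst a) * g (snd a z))"
    by (intro B.integrable_const_bound[where B="c * d"]) auto
  have m: "(\<lambda>m. m z) \<in> measurable ?P (measure_pmf (K z))"
    by (rule measurable_component_singleton) simp
  have "(\<integral>m. g (m z) \<partial>?P) = (\<integral>z'. g z' \<partial>distr ?P (measure_pmf (K z)) (\<lambda>m. m z))"
    by (rule integral_distr[symmetric, OF m]) simp
  also have "distr ?P (measure_pmf (K z)) (\<lambda>m. m z) = measure_pmf (K z)"
    by (rule distr_PiM_component) (auto simp: measure_pmf.prob_space_axioms)
  finally have g_eq: "(\<integral>m. g (m z) \<partial>?P) = (\<integral>z'. g z' \<partial>K z)" .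
  have "(\<integral>a. f (fst a) * g (snd a z) \<partial>B) = (\<integral>w. (\<integral>m. f w * g (m z) \<partial>?P) \<partial>E)"
    using integral_fst'[of "\<lambda>a. f (fst a) * g (snd a z)"] int by (simp add: mark_space_def)
  then show ?thesis
    by (simp add: g_eq)
qed

text \<open>The truncation \<open>max 0 s\<close> covers negative thresholds, which arise when a
  waiting time is subtracted from \<open>s\<close>.\<close>

lemma exp_E_gt: "measure E {s<..} = exp (- Lam * max 0 s)"
proof -
  have "emeasure E {..s} = ennreal (if 0 \<le> s then 1 - exp (- Lam * s) else 0)"
    using emeasure_erlang_density[OF Lam_pos, of 0 s] by (simp add: erlang_CDF_0)
  then have "measure E {..s} = (if 0 \<le> s then 1 - exp (- Lam * s) else 0)"
    using Lam_pos by (simp add: measure_def)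
  moreover have "measure E {s<..} = 1 - measure E {..s}"
    using E.prob_compl[of "{..s}"] by (simp add: Compl_eq_Diff_UNIV[symmetric] Compl_atMost)
  ultimately show ?thesis
    by (simp add: max_def)
qed

lemma AE_E_nonneg: "AE w in E. 0 \<le> w"
proof -
  have "emeasure E {..0} = 0"
    using emeasure_erlang_density[OF Lam_pos, of 0 0] by (simp add: erlang_CDF_0)
  then have "AE w in E. w \<notin> {..0}"
    by (intro AE_not_in) (simp add: null_setsI)
  then show ?thesis by eventually_elim auto
qed

text \<open>This is the renewal identity behind thinning: if each tick succeeds with probability
  \<open>r\<close>, the time of the first success is exponential with rate \<open>r * Lam\<close>.
  Either the first tick succeeds after \<open>s\<close>, or it fails and the threshold drops by its
  waiting time. Keeping the factor \<open>1 - r\<close> on the left avoids a division at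
  \<open>r = 1\<close>.\<close>

lemma integral_E_exp:
  assumes r: "0 \<le> r" "r \<le> 1"
  shows "(1 - r) * (\<integral>w. exp (- r * Lam * max 0 (s - w)) \<partial>E) =
    exp (- r * Lam * max 0 s) - r * exp (- Lam * max 0 s)"
proof (cases "0 \<le> s")
  case False
  have "(\<integral>w. exp (- r * Lam * max 0 (s - w)) \<partial>E) = (\<integral>w. 1 \<partial>E)"
  proof (rule integral_cong_AE)
    show "AE w in E. exp (- r * Lam * max 0 (s - w)) = 1"
      using AE_E_nonneg by eventually_elim (use False in simp)
  qed simp_all
  then show ?thesis using False E.prob_space by (simp add: max_def)
next
  case True
  \<comment> \<open>On \<open>{0..s}\<close> this is \<open>1 - r\<close> times the density times
    the integrand, and it is the derivative of
    \<open>- exp (- Lam * w - r * Lam * (s - w))\<close>.\<close>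
  let ?f = "\<lambda>w. (1 - r) * Lam * exp (- Lam * w - r * Lam * (s - w))"
  have "integral\<^sup>L lborel (\<lambda>w. ?f w * indicator {0..s} w) =
      - exp (- Lam * s - r * Lam * (s - s)) - - exp (- Lam * 0 - r * Lam * (s - 0))"
    by (rule integral_FTC_Icc_real[OF True])
       (auto intro!: derivative_eq_intros continuous_intros simp: algebra_simps)
  then have FTC: "integral\<^sup>L lborel (\<lambda>w. ?f w * indicator {0..s} w) = exp (- r * Lam * s) - exp (- Lam * s)"
    by simp
  have bd: "norm (indicator {..s} w * exp (- r * Lam * max 0 (s - w)) :: real) \<le> 1" for w
    using r Lam_pos by (simp add: indicator_def)
  have i1: "integrable E (\<lambda>w. indicator {..s} w * exp (- r * Lam * max 0 (s - w)))"
    by (rule E.integrable_const_bound[where B=1]) (use bd in auto)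
  have i2: "integrable E (\<lambda>w. indicator {s<..} w :: real)"
    by (rule E.integrable_const_bound[where B=1]) (auto simp: indicator_def)
  let ?I = "\<integral>w. indicator {..s} w * exp (- r * Lam * max 0 (s - w)) \<partial>E"
  have "?I = (\<integral>w. exponential_density Lam w *\<^sub>R (indicator {..s} w * exp (- r * Lam * max 0 (s - w))) \<partial>lborel)"
    by (rule integral_density) (auto simp: exponential_density_nonneg[OF Lam_pos])
  then have "(1 - r) * ?I = (\<integral>w. (1 - r) *
      (exponential_density Lam w *\<^sub>R (indicator {..s} w * exp (- r * Lam * max 0 (s - w)))) \<partial>lborel)"
    by simp
  also have "\<dots> = (\<integral>w. ?f w * indicator {0..s} w \<partial>lborel)"
    by (rule Bochner_Integration.integral_cong)
       (auto simp: exponential_density_def indicator_def mult_exp_exp algebra_simps)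
  finally have I: "(1 - r) * ?I = exp (- r * Lam * s) - exp (- Lam * s)"
    using FTC by simp
  have "(\<integral>w. exp (- r * Lam * max 0 (s - w)) \<partial>E) =
      (\<integral>w. indicator {..s} w * exp (- r * Lam * max 0 (s - w)) + indicator {s<..} w \<partial>E)"
    by (rule Bochner_Integration.integral_cong) (auto simp: indicator_def)
  also have "\<dots> = ?I + exp (- Lam * s)"
    using i1 i2 True exp_E_gt[of s] by simp
  finally have "(1 - r) * (\<integral>w. exp (- r * Lam * max 0 (s - w)) \<partial>E) = (1 - r) * ?I + (1 - r) * exp (- Lam * s)"
    by (simp add: algebra_simps)
  then show ?thesis
    unfolding I using True by (simp add: algebra_simps)
qed

lemma AE_mark_nonneg: "AE \<omega> in SS. \<forall>i. 0 \<le> fst (\<omega> !! i)"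
proof -
  have "distr B E fst = E"
    unfolding mark_space_def by (rule Mk.distr_pair_fst)
  then have "AE w in distr B E fst. 0 \<le> w"
    by (rule ssubst) (rule AE_E_nonneg)
  then have "AE a in B. 0 \<le> fst a"
    by (subst (asm) AE_distr_iff) (auto simp: mark_space_def)
  then have "AE \<omega> in SS. stream_all (\<lambda>a. 0 \<le> fst a) \<omega>"
    by (rule B.AE_stream_all[rotated]) measurable
  then show ?thesis
    by (simp add: stream_all_def del: stream_all_iff)
qed

text \<open>Since there are countably many states, almost every mark sends all of them into the
  supports of their kernels at once; along such marks the invariant propagates by induction.\<close>

lemma AE_chain_invariant:
  assumes D: "D z" and step: "\<And>z z'. D z \<Longrightarrow> z' \<in> set_pmf (K z) \<Longrightarrow> D z'"
  shows "AE \<omega> in SS. \<forall>n. D (chain z \<omega> n)"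
proof -
  let ?P = "\<Pi>\<^sub>M z\<in>UNIV. measure_pmf (K z)"
  interpret pair_prob_space E ?P ..
  have [measurable]: "Measurable.pred B (\<lambda>a. snd a z \<in> set_pmf (K z))" for z
    by (rule measurable_compose[OF measurable_apply_mark]) simp
  have "AE m in ?P. m z \<in> set_pmf (K z)" for z
    by (rule AE_PiM_component) (auto simp: measure_pmf.prob_space_axioms AE_measure_pmf)
  moreover have "{a \<in> space B. snd a z \<in> set_pmf (K z)} \<in> sets B" for z
    by measurable
  ultimately have "AE a in B. snd a z \<in> set_pmf (K z)" for z
    unfolding mark_space_def by (intro AE_pair_measure) simp_all
  then have "AE a in B. \<forall>z. snd a z \<in> set_pmf (K z)"
    by (simp add: AE_all_countable)
  then have "AE \<omega> in SS. stream_all (\<lambda>a. \<forall>z. snd a z \<in> set_pmf (K z)) \<omega>"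
    by (rule B.AE_stream_all[rotated]) measurable
  then show ?thesis
  proof eventually_elim
    case (elim \<omega>)
    have "D (chain z \<omega> n)" for n
    proof (induction n)
      case (Suc n)
      have "snd (\<omega> !! n) (chain z \<omega> n) \<in> set_pmf (K (chain z \<omega> n))"
        using elim by (auto simp: stream_all_def simp del: stream_all_iff)
      with Suc step show ?case unfolding chain_Suc_right by blast
    qed (simp add: D)
    then show ?case by blast
  qed
qed

end

section \<open>Projections of the uniformized chain as jump processes\<close>

text \<open>The assumption \<open>rate\<close> is a lumpability condition: off the diagonal, the law
  of the projected step depends on \<open>z\<close> only through \<open>\<phi> z\<close>. The
  assumption \<open>leaves\<close> excludes absorbing states.\<close>

locale uniformized = poisson_clock K Lam
  for K :: "'z::countable \<Rightarrow> 'z pmf" and Lam :: real +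
  fixes \<phi> :: "'z \<Rightarrow> 'a::countable" and q :: "'a \<Rightarrow> 'a \<Rightarrow> real"
  assumes rate: "x \<noteq> \<phi> z \<Longrightarrow> q (\<phi> z) x = Lam * pmf (map_pmf \<phi> (K z)) x"
    and leaves: "pmf (map_pmf \<phi> (K z)) (\<phi> z) < 1"
begin

lemma exit_rate_eq: "exit_rate q (\<phi> z) = Lam * (1 - pmf (map_pmf \<phi> (K z)) (\<phi> z))"
proof -
  have "exit_rate q (\<phi> z) = (\<Sum>\<^sub>\<infinity>x\<in>-{\<phi> z}. Lam * pmf (map_pmf \<phi> (K z)) x)"
    unfolding exit_rate_def by (rule infsum_cong) (simp add: rate)
  also have "\<dots> = Lam * (\<Sum>\<^sub>\<infinity>x\<in>-{\<phi> z}. pmf (map_pmf \<phi> (K z)) x)"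
    by (rule infsum_cmult_right') 
  also have "(\<Sum>\<^sub>\<infinity>x\<in>-{\<phi> z}. pmf (map_pmf \<phi> (K z)) x) = measure (map_pmf \<phi> (K z)) (-{\<phi> z})"
    by (metis measure_pmf_conv_infsetsum infsetsum_infsum pmf_abs_summable)
  also have "\<dots> = 1 - pmf (map_pmf \<phi> (K z)) (\<phi> z)"
    using measure_pmf.prob_compl[of "{\<phi> z}" "map_pmf \<phi> (K z)"]
    by (simp add: Compl_eq_Diff_UNIV measure_pmf_single)
  finally show ?thesis .
qed

definition hits :: "'z \<Rightarrow> 'z sample \<Rightarrow> bool" where
  "hits z \<omega> \<longleftrightarrow> (\<exists>k. \<phi> (chain z \<omega> (Suc k)) \<noteq> \<phi> z)"

text \<open>Counted so that tick number \<open>Suc (last_stay z \<omega>)\<close> makes the first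
  genuine jump of the projection; meaningful only under \<open>hits\<close>.\<close>

definition last_stay :: "'z \<Rightarrow> 'z sample \<Rightarrow> nat" where
  "last_stay z \<omega> = (LEAST k. \<phi> (chain z \<omega> (Suc k)) \<noteq> \<phi> z)"

text \<open>The parameter \<open>C\<close> stands for an arbitrary event of the path restarted at
  the first genuine jump, so that the product formula can be proved one jump at a time.\<close>

definition renewal :: "('z \<Rightarrow> 'z sample \<Rightarrow> bool) \<Rightarrow> 'z \<Rightarrow> real \<Rightarrow> 'z sample \<Rightarrow> bool" where
  "renewal C z s \<omega> \<longleftrightarrow> hits z \<omega> \<and> s < event_time \<omega> (Suc (last_stay z \<omega>)) \<and>
     C (chain z \<omega> (Suc (last_stay z \<omega>))) (sdrop (Suc (last_stay z \<omega>)) \<omega>)"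

lemma hits_Stream: "hits z (a ## \<omega>) \<longleftrightarrow> \<phi> (snd a z) \<noteq> \<phi> z \<or> hits (snd a z) \<omega>"
proof (cases "\<phi> (snd a z) = \<phi> z")
  case True
  have "(\<exists>k. \<phi> (chain (snd a z) \<omega> k) \<noteq> \<phi> z) \<longleftrightarrow> (\<exists>k. \<phi> (chain (snd a z) \<omega> (Suc k)) \<noteq> \<phi> z)"
    using True by (metis chain.simps(1) not0_implies_Suc)
  with True show ?thesis by (simp add: hits_def)
next
  case False
  then show ?thesis by (auto simp: hits_def intro!: exI[of _ 0])
qed

lemma last_stay_Stream_jump: "\<phi> (snd a z) \<noteq> \<phi> z \<Longrightarrow> last_stay z (a ## \<omega>) = 0"
  by (simp add: last_stay_def Least_eq_0)

lemma last_stay_Stream_stay: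
  assumes eq: "\<phi> (snd a z) = \<phi> z" and "hits (snd a z) \<omega>"
  shows "last_stay z (a ## \<omega>) = Suc (last_stay (snd a z) \<omega>)"
proof -
  from assms obtain k where "\<phi> (chain (snd a z) \<omega> (Suc k)) \<noteq> \<phi> z" by (auto simp: hits_def)
  then show ?thesis
    using Least_Suc[of "\<lambda>k. \<phi> (chain z (a ## \<omega>) (Suc k)) \<noteq> \<phi> z" "Suc k"] eq by (simp add: last_stay_def)
qed

text \<open>Decomposition at the first tick. A genuine jump settles the event; a fictitious one
  restarts the same question with the threshold lowered by the elapsed time.\<close>

lemma renewal_Stream:
  "renewal C z s (a ## \<omega>) \<longleftrightarrow>
    (if \<phi> (snd a z) \<noteq> \<phi> z then s < fst a \<and> C (snd a z) \<omega> else renewal C (snd a z) (s - fst a) \<omega>)"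
proof (cases "\<phi> (snd a z) = \<phi> z")
  case True
  then show ?thesis
    by (cases "hits (snd a z) \<omega>") (auto simp: renewal_def hits_Stream last_stay_Stream_stay event_time_Stream)
next
  case False
  then show ?thesis
    by (simp add: renewal_def hits_Stream last_stay_Stream_jump event_time_Stream)
qed

lemma measurable_hits [measurable]: "Measurable.pred SS (hits z)"
  unfolding hits_def[abs_def] by measurable

lemma measurable_last_stay [measurable]: "last_stay z \<in> measurable SS (count_space UNIV)"
  unfolding last_stay_def[abs_def] by measurable

lemma measurable_after_stay:
  assumes "\<And>z. f z \<in> measurable SS N"
  shows "(\<lambda>\<omega>. f (chain z \<omega> (Suc (last_stay z \<omega>))) (sdrop (Suc (last_stay z \<omega>)) \<omega>)) \<in> measurable SS N"
proof (rule measurable_compose_countable[OF _ measurable_last_stay])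
  fix k
  show "(\<lambda>\<omega>. f (chain z \<omega> (Suc k)) (sdrop (Suc k) \<omega>)) \<in> measurable SS N"
    by (rule measurable_compose_countable[OF measurable_compose[OF measurable_sdrop assms] measurable_chain])
qed

lemma measurable_hold [measurable]: "(\<lambda>\<omega>. event_time \<omega> (Suc (last_stay z \<omega>))) \<in> borel_measurable SS"
  by (rule measurable_compose_countable[OF measurable_event_time measurable_compose_countable[OF _ measurable_last_stay]]) simp

lemma measurable_renewal:
  assumes "\<And>z. Measurable.pred SS (C z)"
  shows "Measurable.pred SS (renewal C z s)"
proof -
  note measurable_after_stay[of C, OF assms, measurable]
  show ?thesis unfolding renewal_def[abs_def] by measurable
qed

text \<open>
  Conditioning on the first tick gives the same affine equation for both sides, as functions of \<open>z\<close>
  and of all real \<open>s\<close>; it is a contraction with factor the probability of staying in \<open>x\<close>.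
\<close>
lemma prob_renewal:
  assumes C: "\<And>z. Measurable.pred SS (C z)"
    and C_prob: "\<And>z'. \<phi> z' \<noteq> x \<Longrightarrow> \<P>(\<omega> in SS. C z' \<omega>) = (if \<phi> z' = y then c else 0)"
    and z: "\<phi> z = x"
  shows "\<P>(\<omega> in SS. renewal C z s \<omega>) = jump_prob q x y * c * exp (- exit_rate q x * max 0 s)"
proof -
  \<comment> \<open>\<open>r\<close> is the probability that a tick changes the projected state, and
    \<open>r * j\<close> the probability that it leads to \<open>y\<close> when
    \<open>y \<noteq> x\<close>. By \<open>leaves\<close>, \<open>r\<close> is positive, which makes
    the iteration below contract.\<close>
  define r where "r = exit_rate q x / Lam"
  define j where "j = jump_prob q x y"
  define G where "G z s = \<P>(\<omega> in SS. renewal C z s \<omega>)" for z s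
  define H where "H s = j * c * exp (- r * Lam * max 0 s)" for s
  have stay: "pmf (map_pmf \<phi> (K z)) x = 1 - r" if "\<phi> z = x" for z
    using exit_rate_eq[of z] Lam_pos that by (simp add: r_def)
  have r: "0 < r" "r \<le> 1"
    using stay[OF z] leaves[of z] z pmf_nonneg[of "map_pmf \<phi> (K z)" x] by auto
  have jump: "(if y = x then 0 else pmf (map_pmf \<phi> (K z)) y) = r * j" if "\<phi> z = x" for z
    using rate[of y z] that Lam_pos r by (auto simp: j_def jump_prob_def r_def field_simps)
  have exp_le: "exp (- r * Lam * max 0 s) \<le> 1" for s
    using r Lam_pos by simp
  have H_bd: "\<bar>H s\<bar> \<le> \<bar>j * c\<bar>" for s
    using mult_left_mono[OF exp_le[of s], of "\<bar>j * c\<bar>"] by (simp add: H_def abs_mult)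
  have G_bd: "0 \<le> G z s" "G z s \<le> 1" for z s
    by (auto simp: G_def)
  have [measurable]: "Measurable.pred SS (renewal C z s)" for z s
    by (rule measurable_renewal[OF C])
  have [measurable]: "G z' \<in> borel_measurable borel" for z'
  proof -
    \<comment> \<open>Raising the threshold shrinks the event, so \<open>G z'\<close> is monotone
      and therefore Borel measurable.\<close>
    have "mono (\<lambda>s. - G z' s)"
    proof (intro monoI le_imp_neg_le)
      fix s s' :: real assume "s \<le> s'"
      then show "G z' s' \<le> G z' s"
      proof -
        have "{\<omega>\<in>space SS. renewal C z' s' \<omega>} \<subseteq> {\<omega>\<in>space SS. renewal C z' s \<omega>}"
          using \<open>s \<le> s'\<close> by (auto simp: renewal_def)
        then show ?thesis
          unfolding G_def by (rule SS.finite_measure_mono) measurable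
      qed
    qed
    then have "(\<lambda>s. - (- G z' s)) \<in> borel_measurable borel"
      by (intro borel_measurable_uminus borel_measurable_mono)
    then show ?thesis by simp
  qed
  have [measurable]: "H \<in> borel_measurable borel"
    unfolding H_def[abs_def] by measurable
  let ?new = "\<lambda>z s a. if s < fst a \<and> \<phi> (snd a z) = y then c else 0"
  let ?F = "\<lambda>z s a. if \<phi> (snd a z) \<noteq> x then ?new z s a else G (snd a z) (s - fst a)"
  let ?FH = "\<lambda>z s a. if \<phi> (snd a z) \<noteq> x then ?new z s a else H (s - fst a)"
  have [measurable]: "(\<lambda>a. G (snd a z) (s - fst a)) \<in> borel_measurable B" for z s
    by (rule measurable_compose_countable[where g="\<lambda>a. snd a z"]) measurable
  have [measurable]: "Measurable.pred B (\<lambda>a. \<phi> (snd a z) = x')" for z x'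
    by (rule measurable_compose[OF measurable_apply_mark]) simp
  have F_int: "integrable B (?F z s)" for z s
  proof (rule B.integrable_const_bound[where B="\<bar>c\<bar> + 1"])
    have "norm (?F z s a) \<le> \<bar>c\<bar> + 1" for a
      using G_bd[of "snd a z" "s - fst a"] by auto
    then show "AE a in B. norm (?F z s a) \<le> \<bar>c\<bar> + 1" by blast
  qed measurable
  have FH_int: "integrable B (?FH z s)" for z s
  proof (rule B.integrable_const_bound[where B="\<bar>c\<bar> + \<bar>j * c\<bar>"])
    have "norm (?FH z s a) \<le> \<bar>c\<bar> + \<bar>j * c\<bar>" for a
      using H_bd[of "s - fst a"] by auto
    then show "AE a in B. norm (?FH z s a) \<le> \<bar>c\<bar> + \<bar>j * c\<bar>" by blast
  qed measurable
  have G_step: "G z s = (\<integral>a. ?F z s a \<partial>B)" if z: "\<phi> z = x" for z s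
  proof -
    have F_eq: "\<P>(\<omega> in SS. renewal C z s (a ## \<omega>)) = ?F z s a" for a
      using C_prob[of "snd a z"] z by (cases "s < fst a") (auto simp: renewal_Stream G_def)
    have "ennreal (G z s) = (\<integral>\<^sup>+a. ennreal (?F z s a) \<partial>B)"
      unfolding G_def by (subst B.prob_stream_space) (measurable, simp only: F_eq G_def)
    also have "\<dots> = ennreal (\<integral>a. ?F z s a \<partial>B)"
      by (rule nn_integral_eq_integral[OF F_int]) (simp add: F_eq[symmetric])
    finally show ?thesis
      by (subst (asm) ennreal_inj) (auto simp: G_bd F_eq[symmetric] intro!: integral_nonneg_AE)
  qed
  have H_step: "(\<integral>a. ?FH z s a \<partial>B) = H s" if z: "\<phi> z = x" for z s
  proof -
    let ?g = "\<lambda>z'. if \<phi> z' \<noteq> x \<and> \<phi> z' = y then c else 0"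
    let ?h = "\<lambda>z'. if \<phi> z' = x then 1 else 0 :: real"
    have int1: "integrable B (\<lambda>a. indicator {s<..} (fst a) * ?g (snd a z))"
      by (rule B.integrable_const_bound[where B="\<bar>c\<bar>"]) (auto simp: indicator_def)
    have int2: "integrable B (\<lambda>a. H (s - fst a) * ?h (snd a z))"
      by (rule B.integrable_const_bound[where B="\<bar>j * c\<bar>"]) (use H_bd in auto)
    have "(\<integral>a. ?FH z s a \<partial>B) =
        (\<integral>a. indicator {s<..} (fst a) * ?g (snd a z) + H (s - fst a) * ?h (snd a z) \<partial>B)"
      by (rule Bochner_Integration.integral_cong) auto
    also have "\<dots> = (\<integral>a. indicator {s<..} (fst a) * ?g (snd a z) \<partial>B) + (\<integral>a. H (s - fst a) * ?h (snd a z) \<partial>B)"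
      by (rule Bochner_Integration.integral_add[OF int1 int2])
    also have "(\<integral>a. indicator {s<..} (fst a) * ?g (snd a z) \<partial>B) = (\<integral>w. indicator {s<..} w \<partial>E) * (\<integral>z'. ?g z' \<partial>K z)"
      by (rule integral_mark[where c=1 and d="\<bar>c\<bar>"]) (auto simp: indicator_def)
    also have "(\<integral>w. indicator {s<..} w \<partial>E) = exp (- Lam * max 0 s)"
      using exp_E_gt[of s] by simp
    also have "(\<integral>z'. ?g z' \<partial>K z) = (\<integral>z'. (if y = x then 0 else c) * indicator (\<phi> -` {y}) z' \<partial>K z)"
      by (rule Bochner_Integration.integral_cong) (auto simp: indicator_def)
    also have "\<dots> = r * j * c"
      using jump[OF z] by (cases "y = x") (auto simp: pmf_map)
    also have "(\<integral>a. H (s - fst a) * ?h (snd a z) \<partial>B) = (\<integral>w. H (s - w) \<partial>E) * (\<integral>z'. ?h z' \<partial>K z)"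
      by (rule integral_mark[where c="\<bar>j * c\<bar>" and d=1]) (use H_bd in auto)
    also have "(\<integral>z'. ?h z' \<partial>K z) = (\<integral>z'. indicator (\<phi> -` {x}) z' \<partial>K z)"
      by (rule Bochner_Integration.integral_cong) (auto simp: indicator_def)
    also have "\<dots> = 1 - r"
      using stay[OF z] by (simp add: pmf_map)
    also have "(\<integral>w. H (s - w) \<partial>E) * (1 - r) = j * c * ((1 - r) * (\<integral>w. exp (- r * Lam * max 0 (s - w)) \<partial>E))"
      by (simp add: H_def)
    also have "\<dots> = j * c * (exp (- r * Lam * max 0 s) - r * exp (- Lam * max 0 s))"
      using integral_E_exp[of r s] r by simp
    finally show ?thesis
      by (simp add: H_def algebra_simps)
  qed
  have bound: "\<bar>G z s - H s\<bar> \<le> (1 - r) ^ n * (1 + \<bar>j * c\<bar>)" if "\<phi> z = x" for n z s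
    using that
  proof (induction n arbitrary: z s)
    case 0
    then show ?case using G_bd[of z s] H_bd[of s] by (simp add: abs_le_iff)
  next
    case (Suc n)
    let ?b = "(1 - r) ^ n * (1 + \<bar>j * c\<bar>)"
    have b: "0 \<le> ?b" using r by simp
    have "\<bar>G z s - H s\<bar> = \<bar>\<integral>a. ?F z s a - ?FH z s a \<partial>B\<bar>"
      using G_step[OF Suc.prems] H_step[OF Suc.prems] F_int FH_int
      by (subst Bochner_Integration.integral_diff) auto
    also have "\<dots> \<le> (\<integral>a. \<bar>?F z s a - ?FH z s a\<bar> \<partial>B)"
      by (rule integral_abs_bound)
    \<comment> \<open>The contributions of genuine jumps cancel, and on the rest the induction
      hypothesis applies. The factor \<open>1\<close> gives the integrand the product form required
      by \<open>integral_mark\<close>.\<close>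
    also have "\<dots> \<le> (\<integral>a. 1 * (?b * indicator (\<phi> -` {x}) (snd a z)) \<partial>B)"
    proof (rule integral_mono)
      show "integrable B (\<lambda>a. \<bar>?F z s a - ?FH z s a\<bar>)"
        using F_int FH_int by (intro integrable_abs Bochner_Integration.integrable_diff)
      show "integrable B (\<lambda>a. 1 * (?b * indicator (\<phi> -` {x}) (snd a z)))"
        by (rule B.integrable_const_bound[where B="?b"]) (use b in \<open>auto simp: indicator_def\<close>)
      show "\<bar>?F z s a - ?FH z s a\<bar> \<le> 1 * (?b * indicator (\<phi> -` {x}) (snd a z))" for a
        using Suc.IH[of "snd a z" "s - fst a"] by (auto simp: indicator_def)
    qed
    also have "\<dots> = (\<integral>w. 1 \<partial>E) * (\<integral>z'. ?b * indicator (\<phi> -` {x}) z' \<partial>K z)"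
      by (rule integral_mark[where c=1 and d="?b"]) (use b in \<open>auto simp: indicator_def\<close>)
    also have "\<dots> = (1 - r) ^ Suc n * (1 + \<bar>j * c\<bar>)"
      using stay[OF Suc.prems] E.prob_space by (simp add: pmf_map)
    finally show ?case .
  qed
  have "(\<lambda>n. (1 - r) ^ n * (1 + \<bar>j * c\<bar>)) \<longlonglongrightarrow> 0 * (1 + \<bar>j * c\<bar>)"
    using r by (intro tendsto_mult LIMSEQ_realpow_zero tendsto_const) auto
  then have "\<bar>G z s - H s\<bar> \<le> 0 * (1 + \<bar>j * c\<bar>)"
    by (rule LIMSEQ_le_const) (use bound[OF z] in auto)
  then show ?thesis
    using Lam_pos by (simp add: G_def H_def r_def j_def)
qed

primrec jump_chain :: "nat \<Rightarrow> 'z \<Rightarrow> 'z sample \<Rightarrow> 'a" where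
  "jump_chain 0 z \<omega> = \<phi> z"
| "jump_chain (Suc n) z \<omega> = (if hits z \<omega>
     then jump_chain n (chain z \<omega> (Suc (last_stay z \<omega>))) (sdrop (Suc (last_stay z \<omega>)) \<omega>) else \<phi> z)"

text \<open>
  If the projected chain stays in one state forever, all further holding times are set to the junk
  value \<open>0\<close>, so that such an outcome satisfies neither the events of the product formula nor the
  premise of the path property in \<^const>\<open>ctmc\<close>.
\<close>
primrec hold :: "nat \<Rightarrow> 'z \<Rightarrow> 'z sample \<Rightarrow> real" where
  "hold 0 z \<omega> = (if hits z \<omega> then event_time \<omega> (Suc (last_stay z \<omega>)) else 0)"
| "hold (Suc n) z \<omega> = (if hits z \<omega>
     then hold n (chain z \<omega> (Suc (last_stay z \<omega>))) (sdrop (Suc (last_stay z \<omega>)) \<omega>) else 0)"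

lemma measurable_jump_chain [measurable]: "jump_chain n z \<in> measurable SS (count_space UNIV)"
proof (induction n arbitrary: z)
  case 0
  show ?case by (simp cong: measurable_cong)
next
  case (Suc n)
  note measurable_after_stay[OF Suc, measurable]
  show ?case unfolding jump_chain.simps(2)[abs_def] by measurable
qed

lemma measurable_hold_time [measurable]: "hold n z \<in> borel_measurable SS"
proof (induction n arbitrary: z)
  case 0
  show ?case unfolding hold.simps(1)[abs_def] by measurable
next
  case (Suc n)
  note measurable_after_stay[OF Suc, measurable]
  show ?case unfolding hold.simps(2)[abs_def] by measurable
qed

text \<open>Induction on the number of jumps by splitting off the first one. By the induction
  hypothesis the probability of the remaining event depends on the state after that jump only
  through its projection, as \<open>prob_renewal\<close> requires.\<close>

lemma prob_jump_chain_hold: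
  assumes "y 0 = \<phi> z" "\<And>i. i < n \<Longrightarrow> 0 \<le> s i"
  shows "\<P>(\<omega> in SS. \<forall>i<n. jump_chain (Suc i) z \<omega> = y (Suc i) \<and> s i < hold i z \<omega>) =
    (\<Prod>i<n. jump_prob q (y i) (y (Suc i)) * exp (- exit_rate q (y i) * s i))"
  using assms
proof (induction n arbitrary: y s z)
  case 0
  then show ?case using SS.prob_space by simp
next
  case (Suc n)
  define C where "C z' \<omega> \<longleftrightarrow> \<phi> z' = y 1 \<and>
      (\<forall>i<n. jump_chain (Suc i) z' \<omega> = y (Suc (Suc i)) \<and> s (Suc i) < hold i z' \<omega>)" for z' \<omega>
  define c where "c = (\<Prod>i<n. jump_prob q (y (Suc i)) (y (Suc (Suc i))) * exp (- exit_rate q (y (Suc i)) * s (Suc i)))"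
  have C_meas: "Measurable.pred SS (C z')" for z'
    unfolding C_def[abs_def] by measurable
  have C_prob: "\<P>(\<omega> in SS. C z' \<omega>) = (if \<phi> z' = y 1 then c else 0)" for z'
    using Suc.IH[of "\<lambda>i. y (Suc i)" z' "\<lambda>i. s (Suc i)"] Suc.prems(2) by (simp add: C_def c_def)
  \<comment> \<open>Outside \<open>hits\<close> the first holding time is \<open>0\<close>, so
    \<open>s 0 < hold 0 z \<omega>\<close> fails because \<open>s 0\<close> is nonnegative.\<close>
  have "(\<forall>i<Suc n. jump_chain (Suc i) z \<omega> = y (Suc i) \<and> s i < hold i z \<omega>) \<longleftrightarrow> renewal C z (s 0) \<omega>" for \<omega>
    using Suc.prems(2)[of 0] by (cases "hits z \<omega>") (auto simp: renewal_def C_def All_less_Suc2)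
  then have "\<P>(\<omega> in SS. \<forall>i<Suc n. jump_chain (Suc i) z \<omega> = y (Suc i) \<and> s i < hold i z \<omega>) =
      \<P>(\<omega> in SS. renewal C z (s 0) \<omega>)"
    by presburger
  also have "\<dots> = jump_prob q (y 0) (y 1) * c * exp (- exit_rate q (y 0) * max 0 (s 0))"
    using C_meas C_prob Suc.prems(1) by (intro prob_renewal) auto
  also have "\<dots> = (\<Prod>i<Suc n. jump_prob q (y i) (y (Suc i)) * exp (- exit_rate q (y i) * s i))"
    using Suc.prems(2)[of 0] by (simp add: prod.lessThan_Suc_shift c_def max_def del: prod.lessThan_Suc)
  finally show ?case .
qed

text \<open>A holding interval is a union of tick intervals whose fictitious jumps do not change the
  projection. Later intervals reduce to the first by restarting the path.\<close>

lemma chain_at_hold: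
  assumes "(\<Sum>i<n. hold i z \<omega>) \<le> t" "t < (\<Sum>i<Suc n. hold i z \<omega>)"
  shows "\<exists>k. event_time \<omega> k \<le> t \<and> t < event_time \<omega> (Suc k) \<and> \<phi> (chain z \<omega> k) = jump_chain n z \<omega>"
  using assms
proof (induction n arbitrary: z \<omega> t)
  case 0
  then have t: "0 \<le> t" "hits z \<omega>" "t < event_time \<omega> (Suc (last_stay z \<omega>))" by (auto split: if_splits)
  \<comment> \<open>Taking the least such tick gives \<open>event_time \<omega> k \<le> t\<close> by
    minimality, even though waiting times are not assumed nonnegative here.\<close>
  define k where "k = (LEAST k. t < event_time \<omega> (Suc k))"
  have k: "t < event_time \<omega> (Suc k)" "k \<le> last_stay z \<omega>"
    unfolding k_def by (rule LeastI[of "\<lambda>k. t < event_time \<omega> (Suc k)"], rule t(3)) (rule Least_le, rule t(3))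
  have "event_time \<omega> k \<le> t"
  proof (cases k)
    case (Suc k')
    then have "\<not> t < event_time \<omega> (Suc k')"
      unfolding k_def by (intro not_less_Least) simp
    then show ?thesis using Suc by simp
  qed (use t in simp)
  moreover have "\<phi> (chain z \<omega> k) = \<phi> z"
  proof (cases k)
    case (Suc k')
    then have "k' < last_stay z \<omega>" using k by simp
    then show ?thesis
      using Suc not_less_Least[of k' "\<lambda>k. \<phi> (chain z \<omega> (Suc k)) \<noteq> \<phi> z"]
      by (simp only: last_stay_def) blast
  qed simp
  ultimately show ?case using k by auto
next
  case (Suc n)
  let ?z = "chain z \<omega> (Suc (last_stay z \<omega>))" and ?\<omega> = "sdrop (Suc (last_stay z \<omega>)) \<omega>"
  let ?T = "event_time \<omega> (Suc (last_stay z \<omega>))"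
  have hits: "hits z \<omega>"
  proof (rule ccontr)
    assume "\<not> hits z \<omega>"
    then have "hold i z \<omega> = 0" for i by (cases i) auto
    with Suc.prems show False by simp
  qed
  then have h: "hold 0 z \<omega> = ?T" "hold (Suc i) z \<omega> = hold i ?z ?\<omega>" for i by simp_all
  have "(\<Sum>i<Suc m. hold i z \<omega>) = ?T + (\<Sum>i<m. hold i ?z ?\<omega>)" for m
    by (simp only: sum.lessThan_Suc_shift h)
  with Suc.prems have "(\<Sum>i<n. hold i ?z ?\<omega>) \<le> t - ?T" "t - ?T < (\<Sum>i<Suc n. hold i ?z ?\<omega>)"
    by (simp_all only:)
  from Suc.IH[OF this] obtain k where k: "event_time ?\<omega> k \<le> t - ?T" "t - ?T < event_time ?\<omega> (Suc k)"
    "\<phi> (chain ?z ?\<omega> k) = jump_chain n ?z ?\<omega>" by blast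
  have "event_time \<omega> (Suc (last_stay z \<omega>) + k) \<le> t" "t < event_time \<omega> (Suc (last_stay z \<omega>) + Suc k)"
    using k(1,2) unfolding event_time_add by linarith+
  moreover have "\<phi> (chain z \<omega> (Suc (last_stay z \<omega>) + k)) = jump_chain (Suc n) z \<omega>"
    unfolding chain_add jump_chain.simps if_P[OF hits] by (rule k(3))
  ultimately show ?case
    unfolding add_Suc_right by blast
qed

lemma ctmc_jump_path: "ctmc q (\<phi> z) SS (\<lambda>t \<omega>. \<phi> (jump_path z t \<omega>))"
  unfolding ctmc_def
proof (intro conjI exI[of _ "\<lambda>n. jump_chain n z"] exI[of _ "\<lambda>n. hold n z"] allI impI)
  show "(\<lambda>\<omega>. \<phi> (jump_path z t \<omega>)) \<in> SS \<rightarrow>\<^sub>M count_space UNIV" for t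
    by (rule measurable_compose[OF measurable_jump_path]) simp
  show "AE \<omega> in SS. \<forall>n t. (\<Sum>i<n. hold i z \<omega>) \<le> t \<and> t < (\<Sum>i<Suc n. hold i z \<omega>) \<longrightarrow>
      \<phi> (jump_path z t \<omega>) = jump_chain n z \<omega>"
    using AE_mark_nonneg
  proof eventually_elim
    case (elim \<omega>)
    show ?case
    proof (intro allI impI, elim conjE)
      fix n t assume "(\<Sum>i<n. hold i z \<omega>) \<le> t" "t < (\<Sum>i<Suc n. hold i z \<omega>)"
      from chain_at_hold[OF this] obtain k where k: "event_time \<omega> k \<le> t" "t < event_time \<omega> (Suc k)"
        "\<phi> (chain z \<omega> k) = jump_chain n z \<omega>" by blast
      \<comment> \<open>Nonnegative waiting times make the tick times monotone, so the tick found
        above is the one that \<open>jump_path\<close> selects.\<close>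
      have "(LEAST k. t < event_time \<omega> (Suc k)) = k"
      proof (rule Least_equality[of "\<lambda>k. t < event_time \<omega> (Suc k)", OF k(2)], rule ccontr)
        fix l assume l: "t < event_time \<omega> (Suc l)" "\<not> k \<le> l"
        then have "event_time \<omega> (Suc l) \<le> event_time \<omega> k"
          using elim by (intro event_time_mono) auto
        with l k show False by simp
      qed
      then show "\<phi> (jump_path z t \<omega>) = jump_chain n z \<omega>"
        using k by (simp add: jump_path_def)
    qed
  qed
  fix n and y :: "nat \<Rightarrow> 'a" and s :: "nat \<Rightarrow> real" assume "y 0 = \<phi> z" "\<forall>i<n. 0 \<le> s i"
  then show "\<P>(\<omega> in SS. jump_chain 0 z \<omega> = \<phi> z \<and> (\<forall>i<n. jump_chain (Suc i) z \<omega> = y (Suc i) \<and> s i < hold i z \<omega>)) =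
      (\<Prod>i<n. jump_prob q (y i) (y (Suc i)) * exp (- exit_rate q (y i) * s i))"
    using prob_jump_chain_hold[of y z n s] by simp
qed (use SS.prob_space_axioms in simp_all)

end

text \<open>
  The coupled chain is run at the constant rate \<open>Lam\<close>, so that either coordinate may also make
  fictitious jumps to its current state.
\<close>
lemma ctmc_coupling:
  fixes K :: "'a::countable \<times> 'b::countable \<Rightarrow> ('a \<times> 'b) pmf"
  assumes fst: "uniformized K Lam fst q1" and snd: "uniformized K Lam snd q2"
    and D: "D (x0, y0)" and step: "\<And>z z'. D z \<Longrightarrow> z' \<in> set_pmf (K z) \<Longrightarrow> D z'"
  obtains M :: "(nat \<Rightarrow> real) measure" and X Y where "ctmc q1 x0 M X" "ctmc q2 y0 M Y"
    "AE \<omega> in M. \<forall>t. D (X t \<omega>, Y t \<omega>)"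
proof -
  obtain g :: "('a \<times> 'b) sample \<Rightarrow> nat \<Rightarrow> real" where g: "inj g"
    using inj_sample_embedding by blast
  let ?S = "stream_space (mark_space K Lam)"
  let ?Z = "\<lambda>t \<omega>. jump_path (x0, y0) t (inv g \<omega>)"
  interpret uniformized K Lam fst q1 by (rule fst)
  show ?thesis
  proof
    show "ctmc q1 x0 (embed_measure ?S g) (\<lambda>t \<omega>. fst (?Z t \<omega>))"
      using ctmc_embed_measure[OF uniformized.ctmc_jump_path[OF fst] g, of "(x0, y0)"] by simp
    show "ctmc q2 y0 (embed_measure ?S g) (\<lambda>t \<omega>. snd (?Z t \<omega>))"
      using ctmc_embed_measure[OF uniformized.ctmc_jump_path[OF snd] g, of "(x0, y0)"] by simp
    have "AE \<omega> in ?S. \<forall>t. D (jump_path (x0, y0) t \<omega>)"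
    proof -
      have "AE \<omega> in ?S. \<forall>n. D (chain (x0, y0) \<omega> n)"
        by (rule AE_chain_invariant[where D=D, OF D]) (rule step)
      then show ?thesis
        by eventually_elim (simp add: jump_path_def)
    qed
    then show "AE \<omega> in embed_measure ?S g. \<forall>t. D (fst (?Z t \<omega>), snd (?Z t \<omega>))"
      using g by (simp add: AE_embed_measure)
  qed
qed

section \<open>Coupling of the two queueing systems\<close>

lemma Qbar_eq_sum: "Qbar l i = (\<Sum>s\<in>UNIV. of_bool (i \<le> l s))"
  unfolding Qbar_def by (simp add: of_bool_def sum.If_cases)

text \<open>Double counting: a server contributes once for each level from \<open>m\<close> up to
  its queue length. Truncated subtraction yields \<open>0\<close> for shorter queues.\<close>

lemma Qbar_plus_eq_sum_servers: "Qbar_plus l m = (\<Sum>s\<in>UNIV. Suc (l s) - m)"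
proof -
  have "Qbar_plus l m = (\<Sum>s\<in>UNIV. \<Sum>i=m..Max (range l). of_bool (i \<le> l s))"
    unfolding Qbar_plus_eq_sum Qbar_eq_sum by (rule sum.swap)
  also have "\<dots> = (\<Sum>s\<in>UNIV. Suc (l s) - m)"
  proof (rule sum.cong)
    fix s
    have "l s \<le> Max (range l)" by simp
    then have "{m..Max (range l)} \<inter> {i. i \<le> l s} = {m..l s}"
      by (auto intro: order_trans[OF _ \<open>l s \<le> Max (range l)\<close>])
    then show "(\<Sum>i=m..Max (range l). of_bool (i \<le> l s)) = Suc (l s) - m"
      by (simp add: of_bool_def sum.If_cases)
  qed simp
  finally show ?thesis .
qed

lemma Qbar_plus_rec: "Qbar_plus l m = Qbar l m + Qbar_plus l (Suc m)"
  unfolding Qbar_plus_eq_sum_servers Qbar_eq_sum sum.distrib[symmetric]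
  by (rule sum.cong) auto

text \<open>Stated additively, since differences of natural numbers would be truncated.\<close>

lemma Qbar_plus_upd: "Qbar_plus (l(s := n)) m + (Suc (l s) - m) = Qbar_plus l m + (Suc n - m)"
  unfolding Qbar_plus_eq_sum_servers by (simp add: sum.remove[of UNIV s])

definition dominated :: "('v::finite \<Rightarrow> nat) \<Rightarrow> ('s::finite \<Rightarrow> nat) \<Rightarrow> bool" where
  "dominated a b \<longleftrightarrow> (\<forall>m\<ge>1. Qbar_plus a m \<le> Qbar_plus b m)"

text \<open>Only levels that rise in \<open>a\<close> but not in \<open>b\<close> are critical.
  There the strict inequality assumed one level lower, combined with domination at that lower level,
  gives strict domination and leaves room for the new job.\<close>

lemma dominated_arrival:
  assumes dom: "dominated a b"
    and "\<And>m. \<lbrakk>1 \<le> m; m \<le> a u; b w < m\<rbrakk> \<Longrightarrow> Qbar b m < Qbar a m"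
  shows "dominated (a(u := Suc (a u))) (b(w := Suc (b w)))"
  unfolding dominated_def
proof (intro allI impI)
  fix m :: nat assume m: "1 \<le> m"
  show "Qbar_plus (a(u := Suc (a u))) m \<le> Qbar_plus (b(w := Suc (b w))) m"
  proof (cases "m \<le> Suc (a u) \<and> Suc (b w) < m")
    case True
    \<comment> \<open>The arrival affects levels up to \<open>Suc (a u)\<close>, so the critical
      level \<open>m\<close> is one above the level \<open>p\<close> of the hypothesis; level
      \<open>1\<close> rises in both systems and is never critical.\<close>
    then obtain p where p: "m = Suc p" "1 \<le> p" "p \<le> a u" "b w < p" by (cases m) auto
    then have "Qbar b p < Qbar a p" "Qbar_plus a p \<le> Qbar_plus b p"
      using assms by (auto simp: dominated_def)
    then have "Qbar_plus a m < Qbar_plus b m"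
      using Qbar_plus_rec[of a p] Qbar_plus_rec[of b p] p by simp
    then show ?thesis
      using Qbar_plus_upd[of a u "Suc (a u)" m] Qbar_plus_upd[of b w "Suc (b w)" m] by linarith
  next
    case False
    moreover have "Qbar_plus a m \<le> Qbar_plus b m" using dom m by (simp add: dominated_def)
    ultimately show ?thesis
      using Qbar_plus_upd[of a u "Suc (a u)" m] Qbar_plus_upd[of b w "Suc (b w)" m] by linarith
  qed
qed

text \<open>Only levels that fall in \<open>b\<close> but not in \<open>a\<close> are critical.
  There \<open>rank\<close> forces a strict inequality of \<open>Qbar\<close>, and domination one
  level higher makes that of \<open>Qbar_plus\<close> strict. A departure from an empty server
  changes nothing.\<close>

lemma dominated_departure:
  assumes dom: "dominated a b"
    and rank: "\<And>m. \<lbrakk>Qbar b m \<le> Qbar a m; m \<le> b w\<rbrakk> \<Longrightarrow> m \<le> a v"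
  shows "dominated (a(v := a v - 1)) (b(w := b w - 1))"
  unfolding dominated_def
proof (intro allI impI)
  fix m :: nat assume m: "1 \<le> m"
  have le: "Qbar_plus a m \<le> Qbar_plus b m" "Qbar_plus a (Suc m) \<le> Qbar_plus b (Suc m)"
    using dom m by (auto simp: dominated_def)
  show "Qbar_plus (a(v := a v - 1)) m \<le> Qbar_plus (b(w := b w - 1)) m"
  proof (cases "m \<le> b w \<and> a v < m")
    case True
    then have "Qbar a m < Qbar b m" using rank[of m] by linarith
    then have "Qbar_plus a m < Qbar_plus b m"
      using le Qbar_plus_rec[of a m] Qbar_plus_rec[of b m] by linarith
    then show ?thesis
      using Qbar_plus_upd[of a v "a v - 1" m] Qbar_plus_upd[of b w "b w - 1" m] m by linarith
  next
    case False
    then show ?thesis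
      using le Qbar_plus_upd[of a v "a v - 1" m] Qbar_plus_upd[of b w "b w - 1" m] m by linarith
  qed
qed

section \<open>Matching servers by rank\<close>

text \<open>In a nondecreasing enumeration the positions with queue length at least \<open>m\<close>
  form a final segment, of length \<open>Qbar l m\<close>.\<close>

lemma sorted_nth_ge_iff:
  fixes l :: "'s::finite \<Rightarrow> nat"
  assumes xs: "distinct xs" "set xs = UNIV" "sorted (map l xs)" and i: "i < CARD('s)"
  shows "m \<le> l (xs ! i) \<longleftrightarrow> CARD('s) - i \<le> Qbar l m"
proof -
  have len: "length xs = CARD('s)"
    using distinct_card[OF xs(1)] xs(2) by simp
  have mono: "l (xs ! j) \<le> l (xs ! j')" if "j \<le> j'" "j' < CARD('s)" for j j'
    using sorted_nth_mono[OF xs(3) that(1)] that len by simp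
  let ?J = "{j. j < CARD('s) \<and> m \<le> l (xs ! j)}"
  have bij: "bij_betw ((!) xs) {..<CARD('s)} UNIV"
    by (rule bij_betw_nth[OF xs(1)]) (simp_all add: len xs(2))
  have "bij_betw ((!) xs) ?J {s. m \<le> l s}"
  proof (rule bij_betw_subset[OF bij])
    show "(!) xs ` ?J = {s. m \<le> l s}"
    proof (intro equalityI subsetI)
      fix s assume s: "s \<in> {s. m \<le> l s}"
      obtain j where "j < CARD('s)" "s = xs ! j"
        using bij_betw_imp_surj_on[OF bij] by (metis UNIV_I imageE lessThan_iff)
      with s show "s \<in> (!) xs ` ?J" by blast
    qed blast
  qed blast
  then have J: "card ?J = Qbar l m"
    unfolding Qbar_def by (rule bij_betw_same_card)
  show ?thesis
  proof
    assume "m \<le> l (xs ! i)"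
    then have "j \<in> ?J" if "j \<in> {i..<CARD('s)}" for j
      using mono[of i j] that by simp
    then have "{i..<CARD('s)} \<subseteq> ?J" by blast
    then have "card {i..<CARD('s)} \<le> card ?J" by (intro card_mono) auto
    then show "CARD('s) - i \<le> Qbar l m" using J by simp
  next
    assume *: "CARD('s) - i \<le> Qbar l m"
    show "m \<le> l (xs ! i)"
    proof (rule ccontr)
      assume "\<not> m \<le> l (xs ! i)"
      have "?J \<subseteq> {Suc i..<CARD('s)}"
      proof
        fix j assume j: "j \<in> ?J"
        then have "\<not> j \<le> i"
          using mono[of j i] i \<open>\<not> m \<le> l (xs ! i)\<close> by auto
        with j show "j \<in> {Suc i..<CARD('s)}" by auto
      qed
      then have "card ?J \<le> card {Suc i..<CARD('s)}" by (intro card_mono) auto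
      with * J i show False by simp
    qed
  qed
qed

lemma ex_sorted_enumeration:
  fixes l :: "'s::finite \<Rightarrow> nat"
  obtains xs where "distinct xs" "set xs = UNIV" "sorted (map l xs)"
proof -
  obtain zs where "set zs = (UNIV :: 's set)" "distinct zs"
    using finite_distinct_list[of "UNIV :: 's set"] by auto
  then show ?thesis
    by (intro that[of "sort_key l zs"]) auto
qed

text \<open>Pair the servers at equal positions \<open>i\<close> of two sorted enumerations:
  \<open>m \<le> b (g v)\<close> gives \<open>CARD('s) - i \<le> Qbar b m \<le> Qbar a m\<close>,
  which gives \<open>m \<le> a v\<close>.\<close>

lemma ex_rank_matching:
  fixes a :: "'v::finite \<Rightarrow> nat" and b :: "'s::finite \<Rightarrow> nat"
  assumes card: "CARD('v) = CARD('s)"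
  shows "\<exists>g. bij g \<and> (\<forall>v m. Qbar b m \<le> Qbar a m \<longrightarrow> m \<le> b (g v) \<longrightarrow> m \<le> a v)"
proof -
  obtain xs where xs: "distinct xs" "set xs = UNIV" "sorted (map a xs)" by (rule ex_sorted_enumeration)
  obtain ys where ys: "distinct ys" "set ys = UNIV" "sorted (map b ys)" by (rule ex_sorted_enumeration)
  have bx: "bij_betw ((!) xs) {..<CARD('v)} UNIV"
    using bij_betw_nth[OF xs(1)] xs(2) distinct_card[OF xs(1)] by simp
  have by': "bij_betw ((!) ys) {..<CARD('v)} UNIV"
    using bij_betw_nth[OF ys(1)] ys(2) distinct_card[OF ys(1)] card by simp
  define ix where "ix = inv_into {..<CARD('v)} ((!) xs)"
  have ix: "ix v < CARD('v)" "xs ! ix v = v" for v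
    using bij_betw_inv_into[OF bx] bij_betw_inv_into_right[OF bx] unfolding ix_def[symmetric]
    by (auto dest: bij_betwE)
  have "bij (\<lambda>v. ys ! ix v)"
    using bij_betw_trans[OF bij_betw_inv_into[OF bx] by'] by (simp add: ix_def comp_def)
  moreover have "m \<le> a v" if "Qbar b m \<le> Qbar a m" "m \<le> b (ys ! ix v)" for v m
    using sorted_nth_ge_iff[OF xs ix(1), of m v] sorted_nth_ge_iff[OF ys, of "ix v" m] ix[of v] that card by simp
  ultimately show ?thesis by blast
qed

definition rank_matching :: "('v::finite \<Rightarrow> nat) \<Rightarrow> ('s::finite \<Rightarrow> nat) \<Rightarrow> 'v \<Rightarrow> 's" where
  "rank_matching a b =
     (SOME g. bij g \<and> (\<forall>v m. Qbar b m \<le> Qbar a m \<longrightarrow> m \<le> b (g v) \<longrightarrow> m \<le> a v))"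

lemma rank_matching:
  fixes a :: "'v::finite \<Rightarrow> nat" and b :: "'s::finite \<Rightarrow> nat"
  assumes "CARD('v) = CARD('s)"
  shows "bij (rank_matching a b)"
    and "Qbar b m \<le> Qbar a m \<Longrightarrow> m \<le> b (rank_matching a b v) \<Longrightarrow> m \<le> a v"
  using someI_ex[OF ex_rank_matching[OF assms, of b a]] unfolding rank_matching_def by blast+

text \<open>A secondary allocation leaves the type I counts unchanged. A primary one goes to a
  minimizer over \<open>S\<close>: if it has at least \<open>m\<close> type I jobs, so do all
  servers in \<open>S\<close>, at least \<open>CARD('s) - k\<close> in number, whereas
  \<open>y w < m\<close> at position \<open>k\<close> leaves fewer than that in the reference
  system.\<close>

lemma dominated_allocation:
  fixes x :: "'v::finite aff_state" and y :: "'s::finite \<Rightarrow> nat"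
  assumes card: "CARD('v) = CARD('s)" "k < CARD('s)" "CARD('s) - k \<le> card S"
    and T: "mjsq_tie_rule k T" "w \<in> set_pmf (T y)"
    and u: "u \<in> aff_candidates x S"
    and dom: "dominated (fst \<circ> x) y"
  shows "dominated (fst \<circ> aff_arrival S u x) (y(w := Suc (y w)))"
proof (cases "u \<in> S")
  case False
  then have "fst \<circ> aff_arrival S u x = fst \<circ> x"
    by (auto simp: aff_arrival_def)
  moreover have "Qbar_plus y m \<le> Qbar_plus (y(w := Suc (y w))) m" for m
    using Qbar_plus_upd[of y w "Suc (y w)" m] by linarith
  ultimately show ?thesis
    using dom by (auto simp: dominated_def intro: order_trans)
next
  case True
  have eq: "fst \<circ> aff_arrival S u x = (fst \<circ> x)(u := Suc ((fst \<circ> x) u))"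
    using True by (auto simp: aff_arrival_def)
  \<comment> \<open>By the third rule, or because an idle server has no type I jobs.\<close>
  have min: "fst (x u) \<le> fst (x r)" if "r \<in> S" for r
    using u True that by (auto simp: aff_candidates_def idle_def split: if_splits)
  obtain xs where xs: "distinct xs" "set xs = UNIV" "sorted (map y xs)" "w = xs ! k"
    using T unfolding mjsq_tie_rule_def by fast
  show ?thesis
    unfolding eq
  proof (rule dominated_arrival[OF dom])
    fix m :: nat assume m: "m \<le> (fst \<circ> x) u" "y w < m"
    have "m \<le> (fst \<circ> x) s" if "s \<in> S" for s
      using min[OF that] m by simp
    then have "S \<subseteq> {s. m \<le> (fst \<circ> x) s}" by blast
    then have "card S \<le> Qbar (fst \<circ> x) m"
      unfolding Qbar_def by (intro card_mono) auto
    moreover have "Qbar y m < CARD('s) - k"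
      using sorted_nth_ge_iff[OF xs(1-3) card(2), of m] m xs(4) by simp
    ultimately show "Qbar y m < Qbar (fst \<circ> x) m" using card by simp
  qed
qed

section \<open>The coupling kernel and its marginals\<close>

text \<open>The coin \<open>c\<close> thins type II completions from rate
  \<open>\<mu>\<^sub>1\<close> to rate \<open>\<mu>\<^sub>2\<close>; it has no influence on the type
  I counts.\<close>

definition aff_departure :: "'v aff_state \<Rightarrow> 'v \<Rightarrow> bool \<Rightarrow> 'v aff_state" where
  "aff_departure x v c =
     (if fst (x v) > 0 then x(v := (fst (x v) - 1, snd (x v)))
      else if snd (x v) > 0 \<and> c then x(v := (0, snd (x v) - 1)) else x)"

lemma fst_aff_departure: "fst \<circ> aff_departure x v c = (fst \<circ> x)(v := (fst \<circ> x) v - 1)"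
  by (auto simp: aff_departure_def)

definition aff_arrival_pmf ::
  "('v::finite \<Rightarrow> 'v \<Rightarrow> bool) \<Rightarrow> ('v aff_state \<Rightarrow> 'v set \<Rightarrow> 'v pmf) \<Rightarrow> 'v aff_state \<Rightarrow> 'v aff_state pmf" where
  "aff_arrival_pmf E R x = bind_pmf (pmf_of_set UNIV)
     (\<lambda>v. map_pmf (\<lambda>s. aff_arrival (closed_nbhd E v) s x) (R x (closed_nbhd E v)))"

text \<open>Simultaneous arrivals choose their servers independently, since every admissible pair of
  choices preserves domination. Only departures need the matching by rank.\<close>

definition coupling_kernel ::
  "('v::finite \<Rightarrow> 'v \<Rightarrow> bool) \<Rightarrow> ('v aff_state \<Rightarrow> 'v set \<Rightarrow> 'v pmf) \<Rightarrow> (('s::finite \<Rightarrow> nat) \<Rightarrow> 's pmf) \<Rightarrow>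
   real \<Rightarrow> real \<Rightarrow> real \<Rightarrow> 'v aff_state \<times> ('s \<Rightarrow> nat) \<Rightarrow> ('v aff_state \<times> ('s \<Rightarrow> nat)) pmf" where
  "coupling_kernel E R T lam \<mu>\<^sub>1 \<mu>\<^sub>2 = (\<lambda>(x, y).
     bind_pmf (bernoulli_pmf (lam / (lam + \<mu>\<^sub>1))) (\<lambda>arrival.
       if arrival then pair_pmf (aff_arrival_pmf E R x) (map_pmf (\<lambda>s. y(s := Suc (y s))) (T y))
       else bind_pmf (pmf_of_set UNIV) (\<lambda>v. map_pmf
         (\<lambda>c. (aff_departure x v c,
               let w = rank_matching (fst \<circ> x) y v in y(w := y w - 1)))
         (bernoulli_pmf (\<mu>\<^sub>2 / \<mu>\<^sub>1)))))"

lemma map_fst_coupling_kernel: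
  "map_pmf fst (coupling_kernel E R T lam \<mu>\<^sub>1 \<mu>\<^sub>2 (x, y)) =
     bind_pmf (bernoulli_pmf (lam / (lam + \<mu>\<^sub>1))) (\<lambda>arrival.
       if arrival then aff_arrival_pmf E R x
       else bind_pmf (pmf_of_set UNIV) (\<lambda>v. map_pmf (aff_departure x v) (bernoulli_pmf (\<mu>\<^sub>2 / \<mu>\<^sub>1))))"
  unfolding coupling_kernel_def map_bind_pmf case_prod_conv
  by (intro bind_pmf_cong refl) (simp add: map_fst_pair_pmf map_bind_pmf pmf.map_comp comp_def)

text \<open>The matching depends on both states, but a bijection maps the uniform law to the uniform
  law, so the reference marginal does not depend on \<open>x\<close>.\<close>

lemma map_snd_coupling_kernel:
  fixes R :: "'v::finite aff_state \<Rightarrow> 'v set \<Rightarrow> 'v pmf" and T :: "('s::finite \<Rightarrow> nat) \<Rightarrow> 's pmf"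
  assumes card: "CARD('v) = CARD('s)"
  shows "map_pmf snd (coupling_kernel E R T lam \<mu>\<^sub>1 \<mu>\<^sub>2 (x, y)) =
     bind_pmf (bernoulli_pmf (lam / (lam + \<mu>\<^sub>1))) (\<lambda>arrival.
       if arrival then map_pmf (\<lambda>s. y(s := Suc (y s))) (T y)
       else map_pmf (\<lambda>w. y(w := y w - 1)) (pmf_of_set UNIV))"
proof -
  let ?g = "rank_matching (fst \<circ> x) y"
  let ?dep = "\<lambda>w. y(w := y w - 1)"
  have "map_pmf ?g (pmf_of_set UNIV) = pmf_of_set UNIV"
    using rank_matching(1)[OF card, of "fst \<circ> x" y] by (subst map_pmf_of_set_inj) (auto simp: bij_def)
  then have "map_pmf ?dep (pmf_of_set UNIV) = map_pmf ?dep (map_pmf ?g (pmf_of_set UNIV))"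
    by (simp only:)
  also have "\<dots> = map_pmf (\<lambda>v. ?dep (?g v)) (pmf_of_set UNIV)"
    by (simp only: pmf.map_comp comp_def)
  finally have uniform: "map_pmf ?dep (pmf_of_set UNIV) = map_pmf (\<lambda>v. ?dep (?g v)) (pmf_of_set UNIV)" .
  show ?thesis
    unfolding uniform
    unfolding coupling_kernel_def map_bind_pmf case_prod_conv
    by (intro bind_pmf_cong refl)
       (simp add: map_snd_pair_pmf map_bind_pmf pmf.map_comp comp_def Let_def map_pmf_def[symmetric])
qed

lemma dominated_coupling_kernel:
  fixes E :: "'v::finite \<Rightarrow> 'v \<Rightarrow> bool" and T :: "('s::finite \<Rightarrow> nat) \<Rightarrow> 's pmf"
  assumes card: "CARD('v) = CARD('s)" "k < CARD('s)" "\<And>v. CARD('s) - k \<le> card (closed_nbhd E v)"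
    and R: "aff_tie_rule E R" and T: "mjsq_tie_rule k T"
    and dom: "dominated (fst \<circ> x) y"
    and z: "(x', y') \<in> set_pmf (coupling_kernel E R T lam \<mu>\<^sub>1 \<mu>\<^sub>2 (x, y))"
  shows "dominated (fst \<circ> x') y'"
proof -
  consider (arrival) v u w where "u \<in> set_pmf (R x (closed_nbhd E v))" "w \<in> set_pmf (T y)"
      "x' = aff_arrival (closed_nbhd E v) u x" "y' = y(w := Suc (y w))"
    | (departure) v c w where "w = rank_matching (fst \<circ> x) y v"
      "x' = aff_departure x v c" "y' = y(w := y w - 1)"
    using z by (auto simp: coupling_kernel_def aff_arrival_pmf_def Let_def split: if_splits)
  then show ?thesis
  proof cases
    case arrival
    then have "u \<in> aff_candidates x (closed_nbhd E v)"
      using R by (auto simp: aff_tie_rule_def)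
    with arrival show ?thesis
      using dominated_allocation[OF card T _ _ dom] by simp
  next
    case departure
    show ?thesis
      unfolding departure fst_aff_departure
      by (rule dominated_departure[OF dom]) (rule rank_matching(2)[OF card(1)])
  qed
qed

section \<open>Transition rates of the marginals\<close>

lemma aff_arrival_neq: "aff_arrival S s x \<noteq> x"
  by (auto simp: aff_arrival_def fun_eq_iff prod_eq_iff)

lemma pmf_bind_uniform:
  "pmf (bind_pmf (pmf_of_set (UNIV :: 'v::finite set)) f) x = (\<Sum>v\<in>UNIV. pmf (f v) x) / real CARD('v)"
  by (simp add: pmf_bind integral_pmf_of_set)

lemma pmf_map_uniform:
  "pmf (map_pmf f (pmf_of_set (UNIV :: 'v::finite set))) x = (\<Sum>v\<in>UNIV. of_bool (f v = x)) / real CARD('v)"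
  unfolding map_pmf_def pmf_bind_uniform by (simp add: indicator_def of_bool_def)

lemma pmf_bernoulli_branch:
  assumes "0 \<le> p" "p \<le> 1"
  shows "pmf (bind_pmf (bernoulli_pmf p) (\<lambda>b. if b then A else B)) x = p * pmf A x + (1 - p) * pmf B x"
  using assms by (simp add: pmf_bind mult.commute)

lemma pmf_map_bernoulli:
  assumes "0 \<le> p" "p \<le> 1"
  shows "pmf (map_pmf f (bernoulli_pmf p)) x = p * of_bool (f True = x) + (1 - p) * of_bool (f False = x)"
  using assms by (simp add: map_pmf_def pmf_bind indicator_def of_bool_def)

lemma pmf_aff_arrival_pmf:
  fixes E :: "'v::finite \<Rightarrow> 'v \<Rightarrow> bool"
  shows "pmf (aff_arrival_pmf E R x) x' = (\<Sum>v\<in>UNIV. measure_pmf.prob (R x (closed_nbhd E v))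
      {s. x' = aff_arrival (closed_nbhd E v) s x}) / real CARD('v)"
proof -
  have "(\<lambda>s. aff_arrival S s x) -` {x'} = {s. x' = aff_arrival S s x}" for S
    by blast
  then show ?thesis
    unfolding aff_arrival_pmf_def pmf_bind_uniform pmf_map by (simp only:)
qed

text \<open>Attempts at empty servers and rejected type II completions land on \<open>x\<close>,
  which \<open>neq\<close> excludes. An accepted type II completion has rate
  \<open>\<mu>\<^sub>1 * (\<mu>\<^sub>2 / \<mu>\<^sub>1)\<close>.\<close>

lemma pmf_aff_departure:
  assumes rates: "0 < \<mu>\<^sub>2" "\<mu>\<^sub>2 < \<mu>\<^sub>1" and neq: "x' \<noteq> x"
  shows "\<mu>\<^sub>1 * pmf (map_pmf (aff_departure x v) (bernoulli_pmf (\<mu>\<^sub>2 / \<mu>\<^sub>1))) x' =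
    (if fst (x v) > 0 \<and> x' = x(v := (fst (x v) - 1, snd (x v))) then \<mu>\<^sub>1 else 0) +
    (if fst (x v) = 0 \<and> snd (x v) > 0 \<and> x' = x(v := (0, snd (x v) - 1)) then \<mu>\<^sub>2 else 0)"
proof -
  have p: "0 \<le> \<mu>\<^sub>2 / \<mu>\<^sub>1" "\<mu>\<^sub>2 / \<mu>\<^sub>1 \<le> 1" and \<mu>: "\<mu>\<^sub>1 * (\<mu>\<^sub>2 / \<mu>\<^sub>1) = \<mu>\<^sub>2"
    using rates by simp_all
  consider "fst (x v) > 0" | "fst (x v) = 0" "snd (x v) > 0" | "fst (x v) = 0" "snd (x v) = 0" by blast
  then show ?thesis
  proof cases
    case 1
    then have "aff_departure x v c = x(v := (fst (x v) - 1, snd (x v)))" for c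
      by (simp add: aff_departure_def)
    with 1 show ?thesis
      unfolding pmf_map_bernoulli[OF p] by (cases "x' = x(v := (fst (x v) - 1, snd (x v)))") auto
  next
    case 2
    then have "aff_departure x v c = (if c then x(v := (0, snd (x v) - 1)) else x)" for c
      by (simp add: aff_departure_def)
    with 2 neq show ?thesis
      unfolding pmf_map_bernoulli[OF p] distrib_left using \<mu> by auto
  next
    case 3
    then have "aff_departure x v c = x" for c
      by (simp add: aff_departure_def)
    with 3 neq show ?thesis
      unfolding pmf_map_bernoulli[OF p] by auto
  qed
qed

text \<open>The clock rate \<open>n * r\<close> cancels both the coin between arrival and departure
  and the uniform choice of a server.\<close>

lemma uniformization_scaling:
  fixes n r a b u v :: real
  assumes "n \<noteq> 0" "r \<noteq> 0"
  shows "n * r * (a / r * (u / n) + b / r * (v / n)) = a * u + b * v"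
  using assms by (simp add: field_simps)

lemma coupling_kernel_fst_rate:
  fixes E :: "'v::finite \<Rightarrow> 'v \<Rightarrow> bool" and T :: "('s::finite \<Rightarrow> nat) \<Rightarrow> 's pmf"
  assumes rates: "0 < lam" "0 < \<mu>\<^sub>2" "\<mu>\<^sub>2 < \<mu>\<^sub>1" and neq: "x' \<noteq> x"
  shows "aff_rate E R lam \<mu>\<^sub>1 \<mu>\<^sub>2 x x' =
    real CARD('v) * (lam + \<mu>\<^sub>1) * pmf (map_pmf fst (coupling_kernel E R T lam \<mu>\<^sub>1 \<mu>\<^sub>2 (x, y))) x'"
proof -
  have p: "0 \<le> lam / (lam + \<mu>\<^sub>1)" "lam / (lam + \<mu>\<^sub>1) \<le> 1" "1 - lam / (lam + \<mu>\<^sub>1) = \<mu>\<^sub>1 / (lam + \<mu>\<^sub>1)"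
    using rates by (simp_all add: field_simps)
  have nonzero: "real CARD('v) \<noteq> 0" "lam + \<mu>\<^sub>1 \<noteq> 0" using rates by simp_all
  show ?thesis
    unfolding map_fst_coupling_kernel pmf_bernoulli_branch[OF p(1,2)] p(3) pmf_aff_arrival_pmf pmf_bind_uniform
      uniformization_scaling[OF nonzero] sum_distrib_left pmf_aff_departure[OF rates(2,3) neq]
    by (simp add: aff_rate_def sum.distrib)
qed

lemma coupling_kernel_snd_rate:
  fixes R :: "'v::finite aff_state \<Rightarrow> 'v set \<Rightarrow> 'v pmf" and T :: "('s::finite \<Rightarrow> nat) \<Rightarrow> 's pmf"
  assumes card: "CARD('v) = CARD('s)" and rates: "0 < lam" "0 < \<mu>\<^sub>1" and neq: "y' \<noteq> y"
  shows "mjsq_rate T lam \<mu>\<^sub>1 y y' =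
    real CARD('v) * (lam + \<mu>\<^sub>1) * pmf (map_pmf snd (coupling_kernel E R T lam \<mu>\<^sub>1 \<mu>\<^sub>2 (x, y))) y'"
proof -
  let ?N = "real CARD('s)"
  let ?D = "\<Sum>w\<in>UNIV. of_bool (y(w := y w - 1) = y')"
  have p: "0 \<le> lam / (lam + \<mu>\<^sub>1)" "lam / (lam + \<mu>\<^sub>1) \<le> 1" "1 - lam / (lam + \<mu>\<^sub>1) = \<mu>\<^sub>1 / (lam + \<mu>\<^sub>1)"
    using rates by (simp_all add: field_simps)
  have nonzero: "?N \<noteq> 0" "lam + \<mu>\<^sub>1 \<noteq> 0" using rates by simp_all
  \<comment> \<open>The reference arrival has no uniform choice of a vertex; the factor
    \<open>?N / ?N\<close> is inserted to fit \<open>uniformization_scaling\<close> and yields the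
    total arrival rate \<open>lam * ?N\<close>.\<close>
  have arrival: "pmf (map_pmf (\<lambda>s. y(s := Suc (y s))) (T y)) y' =
      ?N * measure_pmf.prob (T y) {s. y' = y(s := Suc (y s))} / ?N"
  proof -
    have "(\<lambda>s. y(s := Suc (y s))) -` {y'} = {s. y' = y(s := Suc (y s))}"
      by blast
    then show ?thesis
      using nonzero by (simp add: pmf_map)
  qed
  have departure: "\<mu>\<^sub>1 * ?D = (\<Sum>s\<in>UNIV. if y s > 0 \<and> y' = y(s := y s - 1) then \<mu>\<^sub>1 else 0)"
    unfolding sum_distrib_left
  proof (rule sum.cong)
    fix w
    \<comment> \<open>A departure attempt at an empty server is fictitious and cannot lead to
      \<open>y'\<close>, which differs from \<open>y\<close>.\<close>
    have "y(w := y w - 1) = y" if "y w = 0"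
      using that by auto
    then show "\<mu>\<^sub>1 * of_bool (y(w := y w - 1) = y') = (if y w > 0 \<and> y' = y(w := y w - 1) then \<mu>\<^sub>1 else 0)"
      using neq by auto
  qed simp
  show ?thesis
    unfolding map_snd_coupling_kernel[OF card] pmf_bernoulli_branch[OF p(1,2)] p(3) arrival pmf_map_uniform card
      uniformization_scaling[OF nonzero] departure mjsq_rate_def
    by simp
qed

lemma pmf_bernoulli_branch_less:
  assumes "0 < p" "p \<le> 1" "pmf A x = 0"
  shows "pmf (bind_pmf (bernoulli_pmf p) (\<lambda>b. if b then A else B)) x < 1"
proof -
  have "(1 - p) * pmf B x \<le> (1 - p) * 1"
    using assms by (intro mult_left_mono pmf_le_1) auto
  then show ?thesis
    using assms by (simp add: pmf_bernoulli_branch)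
qed

text \<open>A tick is an arrival with positive probability, and an arrival always changes the state
  of both systems.\<close>

lemma coupling_kernel_leaves:
  fixes R :: "'v::finite aff_state \<Rightarrow> 'v set \<Rightarrow> 'v pmf" and T :: "('s::finite \<Rightarrow> nat) \<Rightarrow> 's pmf"
  assumes rates: "0 < lam" "0 < \<mu>\<^sub>1"
  shows "pmf (map_pmf fst (coupling_kernel E R T lam \<mu>\<^sub>1 \<mu>\<^sub>2 (x, y))) x < 1"
    and "CARD('v) = CARD('s) \<Longrightarrow> pmf (map_pmf snd (coupling_kernel E R T lam \<mu>\<^sub>1 \<mu>\<^sub>2 (x, y))) y < 1"
proof -
  have p: "0 < lam / (lam + \<mu>\<^sub>1)" "lam / (lam + \<mu>\<^sub>1) \<le> 1" using rates by simp_all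
  show "pmf (map_pmf fst (coupling_kernel E R T lam \<mu>\<^sub>1 \<mu>\<^sub>2 (x, y))) x < 1"
    unfolding map_fst_coupling_kernel
    by (rule pmf_bernoulli_branch_less[OF p]) (simp add: pmf_aff_arrival_pmf aff_arrival_neq[symmetric])
  assume "CARD('v) = CARD('s)"
  have "y \<noteq> y(s := Suc (y s))" for s
    by (metis fun_upd_same n_not_Suc_n)
  then have "pmf (map_pmf (\<lambda>s. y(s := Suc (y s))) (T y)) y = 0"
    unfolding pmf_eq_0_set_pmf set_map_pmf by blast
  then show "pmf (map_pmf snd (coupling_kernel E R T lam \<mu>\<^sub>1 \<mu>\<^sub>2 (x, y))) y < 1"
    unfolding map_snd_coupling_kernel[OF \<open>CARD('v) = CARD('s)\<close>]
    by (rule pmf_bernoulli_branch_less[OF p])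
qed

section \<open>Assembly of the stochastic comparison\<close>

theorem theorem3p2:
  fixes E :: "'v::finite \<Rightarrow> 'v \<Rightarrow> bool"
    and R :: "'v aff_state \<Rightarrow> 'v set \<Rightarrow> 'v pmf"
    and T :: "('s::finite \<Rightarrow> nat) \<Rightarrow> 's pmf"
    and x0 :: "'v aff_state"
    and y0 :: "'s \<Rightarrow> nat"
    and lam \<mu>\<^sub>1 \<mu>\<^sub>2 :: real
    and N k :: nat
  assumes "CARD('v) = N" and "CARD('s) = N"
    and "k \<le> N - 1"
    and "symp E" and "irreflp E"
    and "\<And>v. card {w. E v w} \<ge> N - k - 1"
    and "lam > 0" and "\<mu>\<^sub>1 > \<mu>\<^sub>2" and "\<mu>\<^sub>2 > 0"
    and "aff_tie_rule E R"
    and "mjsq_tie_rule k T"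
    and "\<And>m. m \<ge> 1 \<Longrightarrow> Qbar_plus (fst \<circ> x0) m \<le> Qbar_plus y0 m"
  shows "aff_process E R lam \<mu>\<^sub>1 \<mu>\<^sub>2 x0 \<le>\<^sub>s\<^sub>t mjsq_process T lam \<mu>\<^sub>1 y0"
proof -
  let ?K = "coupling_kernel E R T lam \<mu>\<^sub>1 \<mu>\<^sub>2"
  \<comment> \<open>Each of the servers accounts for arrivals at rate \<open>lam\<close> and
    departure attempts at rate \<open>\<mu>\<^sub>1\<close>.\<close>
  let ?Lam = "real CARD('v) * (lam + \<mu>\<^sub>1)"
  have pos: "0 < \<mu>\<^sub>1" "0 < ?Lam"
    using assms(7-9) by simp_all
  have card: "CARD('v) = CARD('s)" "k < CARD('s)"
    using assms(1-3) zero_less_card_finite[where 'a='s] by linarith+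
  \<comment> \<open>By irreflexivity the vertex itself adds one to its degree, which turns
    \<open>N - k - 1\<close> into \<open>N - k\<close>.\<close>
  have nbhd: "CARD('s) - k \<le> card (closed_nbhd E v)" for v
  proof -
    have "v \<notin> {w. E v w}"
      using \<open>irreflp E\<close> by (auto simp: irreflp_def)
    then have "card (closed_nbhd E v) = Suc (card {w. E v w})"
      by (simp add: closed_nbhd_def)
    with assms(6)[of v] show ?thesis
      using card assms(1) by linarith
  qed
  have aff: "uniformized ?K ?Lam fst (aff_rate E R lam \<mu>\<^sub>1 \<mu>\<^sub>2)"
  proof
    fix z :: "'v aff_state \<times> ('s \<Rightarrow> nat)"
    show "aff_rate E R lam \<mu>\<^sub>1 \<mu>\<^sub>2 (fst z) x = ?Lam * pmf (map_pmf fst (?K z)) x" if "x \<noteq> fst z" for x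
      using coupling_kernel_fst_rate[OF assms(7,9,8) that, of E R T "snd z"] by simp
    show "pmf (map_pmf fst (?K z)) (fst z) < 1"
      using coupling_kernel_leaves(1)[OF assms(7) pos(1), of E R T \<mu>\<^sub>2 "fst z" "snd z"] by simp
  qed (rule pos)
  have mjsq: "uniformized ?K ?Lam snd (mjsq_rate T lam \<mu>\<^sub>1)"
  proof
    fix z :: "'v aff_state \<times> ('s \<Rightarrow> nat)"
    show "mjsq_rate T lam \<mu>\<^sub>1 (snd z) y = ?Lam * pmf (map_pmf snd (?K z)) y" if "y \<noteq> snd z" for y
      using coupling_kernel_snd_rate[OF card(1) assms(7) pos(1) that, of T E R \<mu>\<^sub>2 "fst z"] by simp
    show "pmf (map_pmf snd (?K z)) (snd z) < 1"
      using coupling_kernel_leaves(2)[OF assms(7) pos(1) card(1), of E R T \<mu>\<^sub>2 "fst z" "snd z"] by simp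
  qed (rule pos)
  let ?D = "\<lambda>z :: 'v aff_state \<times> ('s \<Rightarrow> nat). dominated (fst \<circ> fst z) (snd z)"
  have init: "?D (x0, y0)"
    using assms(12) by (simp add: dominated_def)
  have step: "?D z'" if "?D z" "z' \<in> set_pmf (?K z)" for z z'
    using dominated_coupling_kernel[OF card nbhd assms(10,11), of "fst z" "snd z" "fst z'" "snd z'"] that
    by simp
  obtain M :: "(nat \<Rightarrow> real) measure" and X Y where
    XY: "ctmc (aff_rate E R lam \<mu>\<^sub>1 \<mu>\<^sub>2) x0 M X" "ctmc (mjsq_rate T lam \<mu>\<^sub>1) y0 M Y"
      and dom: "AE \<omega> in M. \<forall>t. ?D (X t \<omega>, Y t \<omega>)"
    by (rule ctmc_coupling[where D="?D", OF aff mjsq init]) (erule (1) step, blast)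
  have "prob_space M"
    using XY(1) by (simp add: ctmc_def)
  moreover have "AE \<omega> in M. \<forall>m\<ge>1. \<forall>t\<ge>0. Qbar_plus (fst \<circ> X t \<omega>) m \<le> Qbar_plus (Y t \<omega>) m"
    using dom by eventually_elim (simp add: dominated_def)
  ultimately show ?thesis
    unfolding st_le_def aff_process_def mjsq_process_def using XY by blast
qed

end
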